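(* Let $n \geq 15$ be an integer and let $G$ be a graph on $n$ vertices that is $K_4$-saturated and has minimum degree $\delta(G) = 4$. Then $G$ contains at least $2n-4$ triangles. Furthermore, if $G$ contains exactly $2n-4$ triangles, then $G$ is isomorphic to $H_4(n)$.
   Context: A graph $G$ is $K_s$-saturated if $G$ contains no copy of $K_s$ but adding any edge between two nonadjacent vertices of $G$ creates a copy of $K_s$. For $n \geq 9$, $H_4(n)$ denotes the graph with vertex set $\{x, x_1,x_2,x_3,x_4, b_{123}, b_{124}, b_{134}, b_{234}, z_1,\dots,z_{n-9}\}$ and edge set consisting of: $xx_i$ for $i=1,2,3,4$; $x_1x_2$ and $x_3x_4$; $b_{ijk}x_r$ whenever $r \in \{i,j,k\}$; $b_{123}b_{134}$, $b_{123}b_{234}$, $b_{124}b_{134}$, $b_{124}b_{234}$; and $z_jx_r$ for all $1 \le j \le n-9$ and $r \in\{1,2,3,4\}$. There are no other edges. *)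

theory Defs
  imports "Graph_Theory.Graph_Theory"
begin

text \<open>
  Finite simple graphs are the \<open>pair_graph\<close>s of \<open>Graph_Theory\<close>: loop-free symmetric digraphs on a
  finite vertex set whose arcs are pairs of vertices, the edge \<open>uv\<close> being the two arcs
  \<open>(u,v)\<close> and \<open>(v,u)\<close>.
\<close>

definition complete_subgraphs :: "nat \<Rightarrow> 'a pair_pre_digraph \<Rightarrow> 'a pair_pre_digraph set" where
  "complete_subgraphs s G =
     {H. subgraph (with_proj H) (with_proj G) \<and> complete_digraph s (with_proj H)}"

lemma bij_betw_complete_subgraphs:
  assumes "pair_graph G"
  shows "bij_betw pverts (complete_subgraphs s G)
    {S. S \<subseteq> pverts G \<and> card S = s \<and> (\<forall>u\<in>S. \<forall>v\<in>S. u \<noteq> v \<longrightarrow> (u, v) \<in> parcs G)}"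
proof -
  interpret pair_graph G by fact
  let ?K = "\<lambda>S. \<lparr>pverts = S, parcs = {(u, v). (u, v) \<in> S \<times> S \<and> u \<noteq> v}\<rparr>"
  have K: "H = ?K (pverts H)" if "H \<in> complete_subgraphs s G" for H
    using that by (intro pair_pre_digraph.equality)
      (auto simp: complete_subgraphs_def complete_digraph_pair_def)
  show ?thesis
  proof (rule bij_betw_byWitness[where f' = ?K])
    show "\<forall>H \<in> complete_subgraphs s G. ?K (pverts H) = H"
      using K by (metis (no_types, lifting))
    show "\<forall>S \<in> {S. S \<subseteq> pverts G \<and> card S = s \<and>
        (\<forall>u\<in>S. \<forall>v\<in>S. u \<noteq> v \<longrightarrow> (u, v) \<in> parcs G)}. pverts (?K S) = S"
      by simp
    show "pverts ` complete_subgraphs s G \<subseteq> {S. S \<subseteq> pverts G \<and> card S = s \<and>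
        (\<forall>u\<in>S. \<forall>v\<in>S. u \<noteq> v \<longrightarrow> (u, v) \<in> parcs G)}"
      by (auto simp: complete_subgraphs_def complete_digraph_pair_def subgraph_def)
    show "?K ` {S. S \<subseteq> pverts G \<and> card S = s \<and>
        (\<forall>u\<in>S. \<forall>v\<in>S. u \<noteq> v \<longrightarrow> (u, v) \<in> parcs G)} \<subseteq> complete_subgraphs s G"
    proof (rule image_subsetI)
      fix S assume "S \<in> {S. S \<subseteq> pverts G \<and> card S = s \<and>
        (\<forall>u\<in>S. \<forall>v\<in>S. u \<noteq> v \<longrightarrow> (u, v) \<in> parcs G)}"
      then have S: "S \<subseteq> pverts G" "card S = s"
        "\<And>u v. u \<in> S \<Longrightarrow> v \<in> S \<Longrightarrow> u \<noteq> v \<Longrightarrow> (u, v) \<in> parcs G" by auto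
      have "finite S" using S(1) pair_finite_verts finite_subset by blast
      moreover have "wf_digraph (with_proj (?K S))" by unfold_locales auto
      moreover have "wf_digraph (with_proj G)" by unfold_locales
      ultimately show "?K S \<in> complete_subgraphs s G"
        using S by (auto simp: complete_subgraphs_def complete_digraph_pair_def subgraph_def
            compatible_def)
    qed
  qed
qed

definition add_edge :: "'a pair_pre_digraph \<Rightarrow> 'a \<Rightarrow> 'a \<Rightarrow> 'a pair_pre_digraph" where
  "add_edge G u v = G\<lparr>parcs := parcs G \<union> {(u, v), (v, u)}\<rparr>"

definition complete_saturated :: "nat \<Rightarrow> 'a pair_pre_digraph \<Rightarrow> bool" where
  "complete_saturated s G \<longleftrightarrow>
     complete_subgraphs s G = {} \<and>
     (\<forall>u \<in> pverts G. \<forall>v \<in> pverts G. u \<noteq> v \<and> (u, v) \<notin> parcs G \<longrightarrow>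
        complete_subgraphs s (add_edge G u v) \<noteq> {})"

text \<open>In a symmetric digraph the out-degree of a vertex is its degree as an undirected graph.\<close>

definition min_degree :: "'a pair_pre_digraph \<Rightarrow> nat" where
  "min_degree G = Min (out_degree (with_proj G) ` pverts G)"

definition num_triangles :: "'a pair_pre_digraph \<Rightarrow> nat" where
  "num_triangles G = card (complete_subgraphs 3 G)"

text \<open>
  The vertices \<open>X\<close>, \<open>XI i\<close>, \<open>B i j k\<close>, \<open>Z j\<close> stand for \<open>x\<close>, \<open>x_i\<close>, \<open>b_ijk\<close>, \<open>z_j\<close>.
\<close>

datatype h4_vertex = X | XI nat | B nat nat nat | Z nat

definition h4_triples :: "(nat \<times> nat \<times> nat) set" where
  "h4_triples = {(1,2,3), (1,2,4), (1,3,4), (2,3,4)}"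

definition h4_verts :: "nat \<Rightarrow> h4_vertex set" where
  "h4_verts n = {X} \<union> {XI i | i. i \<in> {1..4}}
     \<union> {B i j k | i j k. (i, j, k) \<in> h4_triples}
     \<union> {Z j | j. j \<in> {1..n - 9}}"

text \<open>Each edge is listed in one orientation only; \<open>H4\<close> adds the reversed arcs.\<close>

definition h4_edges :: "nat \<Rightarrow> (h4_vertex \<times> h4_vertex) set" where
  "h4_edges n = {(X, XI i) | i. i \<in> {1..4}}
     \<union> {(XI 1, XI 2), (XI 3, XI 4)}
     \<union> {(B i j k, XI r) | i j k r. (i, j, k) \<in> h4_triples \<and> r \<in> {i, j, k}}
     \<union> {(B 1 2 3, B 1 3 4), (B 1 2 3, B 2 3 4), (B 1 2 4, B 1 3 4), (B 1 2 4, B 2 3 4)}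
     \<union> {(Z j, XI r) | j r. j \<in> {1..n - 9} \<and> r \<in> {1..4}}"

text \<open>Meaningful for \<open>n \<ge> 9\<close> only, because of the truncated subtraction \<open>n - 9\<close>.\<close>

definition H4 :: "nat \<Rightarrow> h4_vertex pair_pre_digraph" where
  "H4 n = \<lparr>pverts = h4_verts n, parcs = h4_edges n \<union> (h4_edges n)\<inverse>\<rparr>"

lemma h4_verts_eq:
  "h4_verts n = {X, XI 1, XI 2, XI 3, XI 4, B 1 2 3, B 1 2 4, B 1 3 4, B 2 3 4} \<union> Z ` {1..n - 9}"
proof -
  have "{1..4} = {1, 2, 3, 4::nat}" by auto
  then show ?thesis by (auto simp: h4_verts_def h4_triples_def)
qed

lemma card_verts_H4:
  assumes "n \<ge> 9"
  shows "card (pverts (H4 n)) = n"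
proof -
  let ?A = "{X, XI 1, XI 2, XI 3, XI 4, B 1 2 3, B 1 2 4, B 1 3 4, B 2 3 4}"
  have "card (?A \<union> Z ` {1..n - 9}) = card ?A + card (Z ` {1..n - 9})"
    by (rule card_Un_disjoint) auto
  moreover have "card ?A = 9" by simp
  moreover have "card (Z ` {1..n - 9}) = n - 9"
    by (simp add: card_image inj_on_def)
  ultimately show ?thesis using assms by (simp only: H4_def h4_verts_eq pair_pre_digraph.simps)
qed

lemma pair_graph_H4: "pair_graph (H4 n)"
proof
  show "finite (pverts (H4 n))"
    by (simp add: H4_def h4_verts_eq)
  have sub: "h4_edges n \<subseteq> pverts (H4 n) \<times> pverts (H4 n)"
    by (auto simp: H4_def h4_edges_def h4_verts_def h4_triples_def)
  then show "finite (parcs (H4 n))"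
    using \<open>finite (pverts (H4 n))\<close>
    by (auto simp: H4_def intro: finite_subset)
  show "fst e \<in> pverts (H4 n)" "snd e \<in> pverts (H4 n)" "fst e \<noteq> snd e"
    if "e \<in> parcs (H4 n)" for e
  proof -
    have e: "e \<in> h4_edges n \<or> prod.swap e \<in> h4_edges n"
      using that by (cases e) (auto simp: H4_def)
    then show "fst e \<in> pverts (H4 n)" "snd e \<in> pverts (H4 n)"
      using sub by (cases e; auto)+
    from e show "fst e \<noteq> snd e"
      by (cases e) (auto simp: h4_edges_def h4_triples_def)
  qed
  show "symmetric (with_proj (H4 n))"
    by (auto simp: symmetric_def H4_def intro!: symI)
qed

end

(*
  Fix a vertex x of degree 4 and let U be the set of vertices outside its closed neighbourhood N[x].
  Saturation makes every u in U adjacent to both ends of an edge of G[N(x)].  Triangles are counted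
  by their number of vertices in U; those with two vertices in U come from the edges uv of U,
  weighted by the number of common neighbours of u and v in N(x).

  G[N(x)] is triangle-free and has no isolated vertex, so it is a matching 2K2, a path P4, a cycle
  C4 or a star K(1,3).  The matching gives the bound 2n - 4, with equality only for H_4(n).  The path
  and the cycle give strictly more.  In the star case the centre d is a dominating vertex and G - d is
  a triangle-free graph of diameter 2 with a vertex of degree 3; the bound needed there is the
  Duffus-Hanson estimate in the range n >= 15, where the hypothesis on n is used in full.
*)

theory Submission
  imports Defs
begin

section \<open>Edges between the parts of a tripartite graph\<close>

text \<open>Each vertex of U is charged 2 triangles. It is credited with the edges of
  \<open>G[N(x)]\<close> that it sees and with half of the common neighbours in N(x) on its edges
  inside U. In the matching case a vertex joined to all of N(x) meets its charge exactly, which is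
  why the number of vertices z_j is unrestricted in H_4(n). Why 15: if d is dominating, the
  triangles are the edges of G - d. The Duffus-Hanson bound 3 m - 15 at m = n - 1 is 3 n - 18, and
  this exceeds 2 n - 4 precisely from n = 15 on. Only this comparison is proved, in the form card U
  >= 10, by splitting U according to the neighbours seen among the three leaves and bounding the
  edges between the classes. The cycle is the one case where triangles inside U enter the count: its
  classes may fail to be joined completely, but each failure exhibits two such triangles.\<close>

definition cross_edges :: "('a \<Rightarrow> 'a \<Rightarrow> bool) \<Rightarrow> 'a set \<Rightarrow> 'a set \<Rightarrow> nat" where
  "cross_edges E A D = card {(a, b). a \<in> A \<and> b \<in> D \<and> E a b}"

lemma finite_cross_edges:
  assumes "finite A" "finite D"
  shows "finite {(a, b). a \<in> A \<and> b \<in> D \<and> E a b}"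
  by (rule finite_subset[of _ "A \<times> D"]) (use assms in auto)

lemma cross_edges_eq_sum:
  assumes "finite A" "finite D"
  shows "cross_edges E A D = (\<Sum>a\<in>A. card {b \<in> D. E a b})"
proof -
  have "{(a, b). a \<in> A \<and> b \<in> D \<and> E a b} = Sigma A (\<lambda>a. {b \<in> D. E a b})"
    by auto
  then show ?thesis
    unfolding cross_edges_def using assms by simp
qed

lemma cross_edges_commute:
  assumes "\<And>u v. E u v \<Longrightarrow> E v u"
  shows "cross_edges E A D = cross_edges E D A"
  unfolding cross_edges_def
  by (rule bij_betw_same_card[of prod.swap])
    (auto simp: bij_betw_def inj_on_def image_iff intro: assms)

lemma cross_edges_split:
  assumes "finite A" "finite D" "finite A'" "finite B'" "A' \<subseteq> A" "B' \<subseteq> D"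
    and "P \<subseteq> {(a, b). a \<in> A \<and> b \<in> D \<and> E a b}"
    and "\<And>a b. (a, b) \<in> P \<Longrightarrow> a \<notin> A' \<or> b \<notin> B'"
  shows "card P + cross_edges E A' B' \<le> cross_edges E A D"
proof -
  let ?Q = "{(a, b). a \<in> A' \<and> b \<in> B' \<and> E a b}"
  have fin: "finite {(a, b). a \<in> A \<and> b \<in> D \<and> E a b}"
    using assms by (intro finite_cross_edges)
  have "finite P" "finite ?Q"
    using fin assms by (auto intro: finite_subset finite_cross_edges)
  then have "card (P \<union> ?Q) = card P + card ?Q"
    using assms(8) by (intro card_Un_disjoint) auto
  moreover have "card (P \<union> ?Q) \<le> card {(a, b). a \<in> A \<and> b \<in> D \<and> E a b}"
    using assms by (intro card_mono fin) auto
  ultimately show ?thesis by (simp add: cross_edges_def)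
qed

lemma cross_edges_ge_card:
  assumes "finite A" "finite D" "\<And>a. a \<in> A \<Longrightarrow> \<exists>b\<in>D. E a b"
  shows "card A \<le> cross_edges E A D"
proof -
  have "1 \<le> card {b \<in> D. E a b}" if "a \<in> A" for a
    using assms(3)[OF that] assms(2) by (auto simp: Suc_le_eq card_gt_0_iff)
  then have "(\<Sum>a\<in>A. 1) \<le> (\<Sum>a\<in>A. card {b \<in> D. E a b})"
    by (intro sum_mono) auto
  then show ?thesis using assms by (simp add: cross_edges_eq_sum)
qed

text \<open>If y has minimal degree \<open>\<delta>\<close> in A, then every non-neighbour of y in D or C is joined to a
  neighbour of y on the other side, so at least \<open>card D + card C - \<delta>\<close> edges run between
  D and C.\<close>

lemma tripartite_edges_ge:
  assumes fin: "finite A" "finite D" "finite C" and ne: "A \<noteq> {}"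
    and AB: "\<And>y p. y \<in> A \<Longrightarrow> p \<in> D \<Longrightarrow> \<not> E y p \<Longrightarrow> \<exists>q\<in>C. E y q \<and> E p q"
    and AC: "\<And>y q. y \<in> A \<Longrightarrow> q \<in> C \<Longrightarrow> \<not> E y q \<Longrightarrow> \<exists>p\<in>D. E y p \<and> E p q"
    and k: "\<And>y. y \<in> A \<Longrightarrow> k \<le> card {p \<in> D. E y p} + card {q \<in> C. E y q}"
  shows "k * (card A - 1) + card D + card C
    \<le> cross_edges E A D + cross_edges E A C + cross_edges E D C"
proof -
  let ?d = "\<lambda>y. card {p \<in> D. E y p} + card {q \<in> C. E y q}"
  obtain y where y: "y \<in> A" "\<And>z. z \<in> A \<Longrightarrow> ?d y \<le> ?d z"
    using ne ex_has_least_nat[of "\<lambda>z. z \<in> A" _ ?d] by blast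
  have "card A * ?d y \<le> (\<Sum>z\<in>A. ?d z)"
    using sum_mono[of A "\<lambda>_. ?d y" ?d] y by simp
  also have "\<dots> = cross_edges E A D + cross_edges E A C"
    using fin by (simp add: cross_edges_eq_sum sum.distrib)
  finally have 1: "card A * ?d y \<le> cross_edges E A D + cross_edges E A C" .
  let ?By = "{p \<in> D. E y p}" and ?Cy = "{q \<in> C. E y q}"
  obtain f where f: "\<And>p. p \<in> D - ?By \<Longrightarrow> f p \<in> ?Cy \<and> E p (f p)"
    using AB[OF y(1)] by (metis (no_types, lifting) DiffE mem_Collect_eq)
  obtain g where g: "\<And>q. q \<in> C - ?Cy \<Longrightarrow> g q \<in> ?By \<and> E (g q) q"
    using AC[OF y(1)] by (metis (no_types, lifting) DiffE mem_Collect_eq)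
  \<comment> \<open>These two families of edges are disjoint: the end in D is a non-neighbour of
    \<open>y\<close> in the first and a neighbour of \<open>y\<close> in the second.\<close>
  let ?P = "(\<lambda>p. (p, f p)) ` (D - ?By)" and ?Q = "(\<lambda>q. (g q, q)) ` (C - ?Cy)"
  have "card (?P \<union> ?Q) = card (D - ?By) + card (C - ?Cy)"
    using fin g by (subst card_Un_disjoint) (auto simp: card_image inj_on_def)
  moreover have "card (?P \<union> ?Q) \<le> cross_edges E D C"
    unfolding cross_edges_def using f g fin
    by (intro card_mono finite_cross_edges) auto
  moreover have "card (D - ?By) = card D - card ?By" "card (C - ?Cy) = card C - card ?Cy"
    using fin by (auto intro!: card_Diff_subset)
  ultimately have 2: "card D + card C \<le> cross_edges E D C + ?d y" by linarith
  have "k * (card A - 1) \<le> ?d y * (card A - 1)"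
    using k[OF y(1)] by simp
  moreover have "?d y * (card A - 1) + ?d y = card A * ?d y"
    using y(1) fin by (cases "card A") (auto simp: algebra_simps)
  ultimately show ?thesis using 1 2 by linarith
qed

text \<open>Deleting u, v and their common neighbours Y in A leaves a tripartite graph to which the previous
  lemma applies with \<open>k = 2\<close>.\<close>

lemma tripartite_degree2_edges_ge:
  assumes fin: "finite A" "finite D" "finite C" 
    and disj: "A \<inter> D = {}" "A \<inter> C = {}" "D \<inter> C = {}"
    and sym: "\<And>u v. E u v \<Longrightarrow> E v u"
    and tri: "\<And>u v w. E u v \<Longrightarrow> E v w \<Longrightarrow> E u w \<Longrightarrow> False"
    and AB: "\<And>y p. y \<in> A \<Longrightarrow> p \<in> D \<Longrightarrow> \<not> E y p \<Longrightarrow> \<exists>q\<in>C. E y q \<and> E p q"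
    and AC: "\<And>y q. y \<in> A \<Longrightarrow> q \<in> C \<Longrightarrow> \<not> E y q \<Longrightarrow> \<exists>p\<in>D. E y p \<and> E p q"
    and nA: "\<And>y. y \<in> A \<Longrightarrow> \<exists>p\<in>D. E y p" "\<And>y. y \<in> A \<Longrightarrow> \<exists>q\<in>C. E y q"
    and nB: "\<And>p. p \<in> D \<Longrightarrow> \<exists>y\<in>A. E y p"
    and nC: "\<And>q. q \<in> C \<Longrightarrow> \<exists>y\<in>A. E y q"
    and y: "y \<in> A" "{p \<in> D. E y p} = {u}" "{q \<in> C. E y q} = {v}"
  shows "2 * (card A + card D + card C)
    \<le> cross_edges E A D + cross_edges E A C + cross_edges E D C + 6"
proof -
  have u: "u \<in> D" "E y u" "\<And>p. p \<in> D \<Longrightarrow> E y p \<Longrightarrow> p = u" using y by auto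
  have v: "v \<in> C" "E y v" "\<And>q. q \<in> C \<Longrightarrow> E y q \<Longrightarrow> q = v" using y by auto
  define B' where "B' = D - {u}"
  define C' where "C' = C - {v}"
  define Y where "Y = {z \<in> A. E z u}"
  define R where "R = A - Y"
  have uC: "E u q" if "q \<in> C'" for q
    using AC[OF y(1), of q] u v that unfolding C'_def by blast
  have vB: "E p v" if "p \<in> B'" for p
    using AB[OF y(1), of p] u v that unfolding B'_def by blast
  \<comment> \<open>A neighbour of \<open>z\<close> in C other than \<open>v\<close> lies in
    \<open>C'\<close>, hence is adjacent to \<open>u\<close> and closes a triangle. With the mirror
    image \<open>Yu\<close>, the vertices \<open>u\<close> and \<open>v\<close> have the same
    neighbours in A.\<close>
  have Yv: "E z v" if "z \<in> A" "E z u" for z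
    using nA(2)[OF that(1)] uC tri that C'_def by blast
  have Yu: "E z u" if "z \<in> A" "E z v" for z
    using nA(1)[OF that(1)] vB tri sym that B'_def by blast
  have cA: "card A = card Y + card R"
    unfolding R_def Y_def using fin by (simp add: card_Diff_subset card_mono)
  have cB: "card D = card B' + 1" unfolding B'_def using card.remove[OF fin(2) u(1)] by simp
  have cC: "card C = card C' + 1" unfolding C'_def using card.remove[OF fin(3) v(1)] by simp
  have finR: "finite R" "finite Y" "finite B'" "finite C'"
    unfolding R_def Y_def B'_def C'_def using fin by auto
  have sub: "R \<subseteq> A" "Y \<subseteq> A" "B' \<subseteq> D" "C' \<subseteq> C"
    unfolding R_def Y_def B'_def C'_def by auto
  have eAB: "card Y + cross_edges E R B' \<le> cross_edges E A D"
  proof -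
    have "card ((\<lambda>z. (z, u)) ` Y) + cross_edges E R B' \<le> cross_edges E A D"
      using fin finR sub u(1) by (intro cross_edges_split) (auto simp: Y_def R_def B'_def)
    then show ?thesis by (simp add: card_image inj_on_def)
  qed
  have eAC: "card Y + cross_edges E R C' \<le> cross_edges E A C"
  proof -
    have "card ((\<lambda>z. (z, v)) ` Y) + cross_edges E R C' \<le> cross_edges E A C"
      using fin finR sub v(1) Yv by (intro cross_edges_split) (auto simp: Y_def R_def C'_def)
    then show ?thesis by (simp add: card_image inj_on_def)
  qed
  have eBC: "card B' + card C' + cross_edges E B' C' \<le> cross_edges E D C"
  proof -
    have "card ((\<lambda>p. (p, v)) ` B' \<union> (\<lambda>q. (u, q)) ` C') + cross_edges E B' C' \<le> cross_edges E D C"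
      using fin finR sub u(1) v(1) uC vB by (intro cross_edges_split) (auto simp: B'_def C'_def)
    moreover have "card ((\<lambda>p. (p, v)) ` B' \<union> (\<lambda>q. (u, q)) ` C') = card B' + card C'"
      using finR by (subst card_Un_disjoint) (auto simp: card_image inj_on_def B'_def)
    ultimately show ?thesis by simp
  qed
  show ?thesis
  proof (cases "R = {}")
    case True
    \<comment> \<open>A vertex of \<open>B'\<close> is adjacent to \<open>v\<close> and to some
      vertex of A, here equal to \<open>Y\<close>, which is adjacent to \<open>v\<close> too: a
      triangle.\<close>
    have "B' = {}"
      using nB vB Yv tri sym True sub unfolding R_def Y_def by blast
    moreover have "C' = {}"
      using nC uC Yu tri sym True sub unfolding R_def Y_def by blast
    ultimately show ?thesis using cA cB cC eAB eAC True by simp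
  next
    case False
    \<comment> \<open>Origin of the 6 in the conclusion: \<open>u\<close> and \<open>v\<close> are
      each short of 2 edges, and the \<open>- 1\<close> here costs another 2.\<close>
    have "2 * (card R - 1) + card B' + card C'
      \<le> cross_edges E R B' + cross_edges E R C' + cross_edges E B' C'"
    proof (rule tripartite_edges_ge[OF finR(1,3,4) False])
      fix r assume r: "r \<in> R"
      then have nr: "r \<in> A" "\<not> E r u" "\<not> E r v" using Yu by (auto simp: R_def Y_def)
      show "\<exists>q\<in>C'. E r q \<and> E p q" if "p \<in> B'" "\<not> E r p" for p
        using AB[OF nr(1), of p] that nr unfolding B'_def C'_def by blast
      show "\<exists>p\<in>B'. E r p \<and> E p q" if "q \<in> C'" "\<not> E r q" for q
        using AC[OF nr(1), of q] that nr unfolding B'_def C'_def by blast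
      have "{p \<in> B'. E r p} \<noteq> {}" "{q \<in> C'. E r q} \<noteq> {}"
        using nA[OF nr(1)] nr unfolding B'_def C'_def by auto
      then have "0 < card {p \<in> B'. E r p}" "0 < card {q \<in> C'. E r q}"
        using finR by (auto simp: card_gt_0_iff)
      then show "2 \<le> card {p \<in> B'. E r p} + card {q \<in> C'. E r q}" by linarith
    qed
    moreover obtain r where "card R = Suc r"
      using False finR by (cases "card R") auto
    ultimately show ?thesis using cA cB cC eAB eAC eBC by simp
  qed
qed

section \<open>Maximal triangle-free graphs around a vertex of degree 3\<close>

text \<open>A triangle-free graph of diameter 2 outside the closed neighbourhood of a vertex of degree 3
  with neighbours 1, 2, 3; \<open>n1\<close>, \<open>n2\<close>, \<open>n3\<close> say which of these a vertex is adjacent to.\<close>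

locale maximal_triangle_free =
  fixes U :: "'a set" and E :: "'a \<Rightarrow> 'a \<Rightarrow> bool" and n1 n2 n3 :: "'a \<Rightarrow> bool"
  assumes fin: "finite U" and U10: "10 \<le> card U"
    and sym: "\<And>u v. E u v \<Longrightarrow> E v u"
    and tri: "\<And>u v w. E u v \<Longrightarrow> E v w \<Longrightarrow> E u w \<Longrightarrow> False"
    and some_n: "\<And>v. v \<in> U \<Longrightarrow> n1 v \<or> n2 v \<or> n3 v"
    and dis: "\<And>u v. u \<in> U \<Longrightarrow> v \<in> U \<Longrightarrow> E u v \<Longrightarrow> \<not> (n1 u \<and> n1 v) \<and> \<not> (n2 u \<and> n2 v) \<and> \<not> (n3 u \<and> n3 v)"
    and com: "\<And>u v. u \<in> U \<Longrightarrow> v \<in> U \<Longrightarrow> u \<noteq> v \<Longrightarrow> \<not> E u v \<Longrightarrow>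
      \<not> (n1 u \<and> n1 v) \<Longrightarrow> \<not> (n2 u \<and> n2 v) \<Longrightarrow> \<not> (n3 u \<and> n3 v) \<Longrightarrow> \<exists>w\<in>U. E u w \<and> E v w"
    and far1: "\<And>v. v \<in> U \<Longrightarrow> \<not> n1 v \<Longrightarrow> \<exists>w\<in>U. E v w \<and> n1 w"
    and far2: "\<And>v. v \<in> U \<Longrightarrow> \<not> n2 v \<Longrightarrow> \<exists>w\<in>U. E v w \<and> n2 w"
    and far3: "\<And>v. v \<in> U \<Longrightarrow> \<not> n3 v \<Longrightarrow> \<exists>w\<in>U. E v w \<and> n3 w"
    and dg: "\<And>v. v \<in> U \<Longrightarrow> 3 \<le> card {w \<in> U. E v w} + of_bool (n1 v) + of_bool (n2 v) + of_bool (n3 v)"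
begin

definition "S1 = {v \<in> U. n1 v \<and> \<not> n2 v \<and> \<not> n3 v}"
definition "S2 = {v \<in> U. \<not> n1 v \<and> n2 v \<and> \<not> n3 v}"
definition "S3 = {v \<in> U. \<not> n1 v \<and> \<not> n2 v \<and> n3 v}"
definition "T1 = {v \<in> U. \<not> n1 v \<and> n2 v \<and> n3 v}"
definition "T2 = {v \<in> U. n1 v \<and> \<not> n2 v \<and> n3 v}"
definition "T3 = {v \<in> U. n1 v \<and> n2 v \<and> \<not> n3 v}"
definition "F = {v \<in> U. n1 v \<and> n2 v \<and> n3 v}"

lemmas cls = S1_def S2_def S3_def T1_def T2_def T3_def F_def

text \<open>Cyclic relabelling of the three neighbours: used once or twice, it carries statements
  about \<open>S1\<close> and \<open>T1\<close> over to the other indices.\<close>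

lemma rot: "maximal_triangle_free U E n2 n3 n1"
proof
  show "3 \<le> card {w \<in> U. E v w} + of_bool (n2 v) + of_bool (n3 v) + of_bool (n1 v)" if "v \<in> U" for v
    using dg[OF that] by linarith
  show "n2 v \<or> n3 v \<or> n1 v" if "v \<in> U" for v
    using some_n[OF that] by blast
  show "\<not> (n2 u \<and> n2 v) \<and> \<not> (n3 u \<and> n3 v) \<and> \<not> (n1 u \<and> n1 v)"
    if "u \<in> U" "v \<in> U" "E u v" for u v
    using dis[OF that] by blast
  show "\<exists>w\<in>U. E u w \<and> E v w" if "u \<in> U" "v \<in> U" "u \<noteq> v" "\<not> E u v"
    "\<not> (n2 u \<and> n2 v)" "\<not> (n3 u \<and> n3 v)" "\<not> (n1 u \<and> n1 v)" for u v
    using com[OF that(1-4,7,5,6)] .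
qed (fact fin U10 | erule sym | erule (2) tri | erule (1) far1 | erule (1) far2 | erule (1) far3)+

lemma fins: "finite S1" "finite S2" "finite S3" "finite T1" "finite T2" "finite T3" "finite F"
  using fin by (auto simp: cls)

lemma U_cases: "U = S1 \<union> S2 \<union> S3 \<union> T1 \<union> T2 \<union> T3 \<union> F"
  using some_n by (auto simp: cls)

lemma disj:
  "S1 \<inter> S2 = {}" "S1 \<inter> S3 = {}" "S2 \<inter> S3 = {}"
  "S1 \<inter> T1 = {}" "S2 \<inter> T1 = {}" "S3 \<inter> T1 = {}" 
  "S1 \<inter> T2 = {}" "S2 \<inter> T2 = {}" "S3 \<inter> T2 = {}" 
  "S1 \<inter> T3 = {}" "S2 \<inter> T3 = {}" "S3 \<inter> T3 = {}" 
  "T1 \<inter> T2 = {}" "T1 \<inter> T3 = {}" "T2 \<inter> T3 = {}"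
  "S1 \<inter> F = {}" "S2 \<inter> F = {}" "S3 \<inter> F = {}" "T1 \<inter> F = {}" "T2 \<inter> F = {}" "T3 \<inter> F = {}"
  by (auto simp: cls)

lemma sum_U:
  "sum g U = sum g S1 + sum g S2 + sum g S3 + sum g T1 + sum g T2 + sum g T3 + sum g F"
proof -
  have "sum g U = sum g (S1 \<union> S2 \<union> S3 \<union> T1 \<union> T2 \<union> T3 \<union> F)"
    using U_cases by (rule arg_cong)
  then show ?thesis
    using fins disj by (simp add: sum.union_disjoint Int_Un_distrib2)
qed

lemma card_U: "card U = card S1 + card S2 + card S3 + card T1 + card T2 + card T3 + card F"
  using sum_U[of "\<lambda>_. 1::nat"] by simp

text \<open>A neighbour of \<open>v\<close> avoids 2 and 3, so it sees only 1. Conversely,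
  \<open>v\<close> and a vertex of \<open>S1\<close> together see all of 1, 2, 3, so a common
  neighbour would see none of them.\<close>

lemma T1_nb:
  assumes "v \<in> T1" shows "{w \<in> U. E v w} = S1"
proof
  show "{w \<in> U. E v w} \<subseteq> S1"
    using assms dis some_n unfolding cls by blast
  show "S1 \<subseteq> {w \<in> U. E v w}"
  proof
    fix w assume w: "w \<in> S1"
    show "w \<in> {w \<in> U. E v w}"
    proof (rule ccontr)
      assume "w \<notin> {w \<in> U. E v w}"
      then have "\<not> E v w" "v \<noteq> w" using w assms by (auto simp: cls)
      then obtain z where "z \<in> U" "E v z" "E w z" using com[of v w] w assms by (auto simp: cls)
      then show False using dis some_n w assms unfolding cls by blast
    qed
  qed
qed

lemma T1_S1: "v \<in> T1 \<Longrightarrow> w \<in> S1 \<Longrightarrow> E v w" "v \<in> T1 \<Longrightarrow> w \<in> S1 \<Longrightarrow> E w v"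
  using T1_nb sym by auto

lemma F_nb:
  assumes "v \<in> F" shows "{w \<in> U. E v w} = {}"
  using assms dis some_n unfolding cls by blast

abbreviation "d v \<equiv> card {w \<in> U. E v w}"
text \<open>Degree of a vertex of \<open>S1\<close> in the tripartite graph H induced on
  \<open>S1\<close>, \<open>S2\<close>, \<open>S3\<close>; the names \<open>H_ge\<close>,
  \<open>H_ge1\<close>, \<open>H_ge2\<close> refer to this H.\<close>

abbreviation "dH1 v \<equiv> card {w \<in> S2. E v w} + card {w \<in> S3. E v w}"

lemma S1_nb:
  assumes "v \<in> S1" shows "d v = dH1 v + card T1"
proof -
  have "{w \<in> U. E v w} = {w \<in> S2. E v w} \<union> {w \<in> S3. E v w} \<union> T1"
  proof
    show "{w \<in> U. E v w} \<subseteq> {w \<in> S2. E v w} \<union> {w \<in> S3. E v w} \<union> T1"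
      using dis[of v] assms some_n by (auto simp: cls)
    show "{w \<in> S2. E v w} \<union> {w \<in> S3. E v w} \<union> T1 \<subseteq> {w \<in> U. E v w}"
      using assms T1_S1 by (auto simp: cls)
  qed
  moreover have "card ({w \<in> S2. E v w} \<union> {w \<in> S3. E v w} \<union> T1) = dH1 v + card T1"
  proof -
    have "({w \<in> S2. E v w} \<union> {w \<in> S3. E v w}) \<inter> T1 = {}"
      "{w \<in> S2. E v w} \<inter> {w \<in> S3. E v w} = {}"
      using disj by auto
    then show ?thesis using fins by (simp add: card_Un_disjoint)
  qed
  ultimately show ?thesis by simp
qed

text \<open>The common neighbour given by \<open>com\<close> avoids 1 and 2, so it sees only 3.
  Together with \<open>S13\<close> this is what \<open>tripartite_edges_ge\<close> asks for.\<close>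

lemma S12:
  assumes "y \<in> S1" "p \<in> S2" "\<not> E y p" shows "\<exists>q\<in>S3. E y q \<and> E p q"
proof -
  obtain w where w: "w \<in> U" "E y w" "E p w"
    using com[of y p] assms by (auto simp: cls)
  then have "w \<in> S3" using dis[of y w] dis[of p w] some_n[of w] assms unfolding cls by blast
  then show ?thesis using w by blast
qed

lemma S13:
  assumes "y \<in> S1" "p \<in> S3" "\<not> E y p" shows "\<exists>q\<in>S2. E y q \<and> E q p"
proof -
  obtain w where w: "w \<in> U" "E y w" "E p w"
    using com[of y p] assms by (auto simp: cls)
  then have "w \<in> S2" using dis[of y w] dis[of p w] some_n[of w] assms unfolding cls by blast
  then show ?thesis using w sym by blast
qed

abbreviation "e12 \<equiv> cross_edges E S1 S2"
abbreviation "e13 \<equiv> cross_edges E S1 S3"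
abbreviation "e23 \<equiv> cross_edges E S2 S3"

lemma H_ge:
  assumes "S1 \<noteq> {}" "\<And>y. y \<in> S1 \<Longrightarrow> k \<le> dH1 y"
  shows "k * (card S1 - 1) + card S2 + card S3 \<le> e12 + e13 + e23"
  using assms fins S12 S13 by (intro tripartite_edges_ge) auto

lemma dH1_pos:
  assumes "y \<in> S1" "S2 \<noteq> {} \<or> S3 \<noteq> {}" shows "1 \<le> dH1 y"
proof -
  have "{w \<in> S2. E y w} \<noteq> {} \<or> {w \<in> S3. E y w} \<noteq> {}"
    using assms S12 S13 by blast
  then show ?thesis using fins by (auto simp: Suc_le_eq card_gt_0_iff)
qed

lemma H_ge1:
  assumes "S1 \<noteq> {}" "S2 \<noteq> {} \<or> S3 \<noteq> {}"
  shows "card S1 + card S2 + card S3 \<le> e12 + e13 + e23 + 1"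
  using H_ge[of 1] assms dH1_pos by fastforce

lemma S1_nbs:
  assumes "y \<in> S1" "T1 = {}" shows "\<exists>w\<in>S2. E y w" "\<exists>w\<in>S3. E y w"
  using far2[of y] far3[of y] dis[of y] assms unfolding cls by blast+

lemma H_ge2:
  assumes "S1 \<noteq> {}" "T1 = {}"
  shows "2 * (card S1 - 1) + card S2 + card S3 \<le> e12 + e13 + e23"
proof (rule H_ge[OF assms(1)])
  fix y assume y: "y \<in> S1"
  have "{w \<in> S2. E y w} \<noteq> {}" "{w \<in> S3. E y w} \<noteq> {}"
    using S1_nbs[OF y assms(2)] by auto
  then have "0 < card {w \<in> S2. E y w}" "0 < card {w \<in> S3. E y w}"
    using fins by (auto simp: card_gt_0_iff)
  then show "2 \<le> dH1 y" by linarith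
qed

lemma e_ge:
  assumes "T1 = {}" shows "card S1 \<le> e12" "card S1 \<le> e13" 
  using S1_nbs[OF _ assms] fins by (auto intro: cross_edges_ge_card)

lemma T1_pos: "T1 \<noteq> {} \<Longrightarrow> S1 \<noteq> {}"
  using T1_nb far1 by (metis (no_types, lifting) T1_def all_not_in_conv mem_Collect_eq)

lemma S_pos: "S1 \<noteq> {} \<Longrightarrow> T1 = {} \<Longrightarrow> S2 \<noteq> {} \<and> S3 \<noteq> {}"
  using S1_nbs by blast

text \<open>The degree condition leaves two neighbours of a vertex of \<open>S1\<close> to be found
  in U, and only \<open>T1\<close> can hold them.\<close>

lemma T1_ge2:
  assumes "S1 \<noteq> {}" "S2 = {}" "S3 = {}" shows "2 \<le> card T1"
proof -
  obtain y where y: "y \<in> S1" using assms by auto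
  have "d y = card T1" using S1_nb[OF y] assms by simp
  then show ?thesis using dg[of y] y by (simp add: cls)
qed

lemma sum_d_S1: "(\<Sum>v\<in>S1. d v) = e12 + e13 + card S1 * card T1"
  using fins by (simp add: S1_nb sum.distrib cross_edges_eq_sum)

lemma sum_d_T1: "(\<Sum>v\<in>T1. d v) = card S1 * card T1"
  by (simp add: T1_nb)

lemma sum_d_F: "(\<Sum>v\<in>F. d v) = 0"
  by (simp add: F_nb)

text \<open>With no T classes, each vertex of \<open>S1\<close> has a neighbour in both
  \<open>S2\<close> and \<open>S3\<close>. Either some vertex has exactly one in each, and the
  deletion argument applies, or all degrees in H are at least 3.\<close>

lemma S1_dichotomy:
  assumes "T1 = {}" "T2 = {}" "T3 = {}"
  shows "2 * (card S1 + card S2 + card S3) \<le> e12 + e13 + e23 + 6 \<or> 3 * card S1 \<le> e12 + e13"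
proof (cases "\<exists>y\<in>S1. dH1 y \<le> 2")
  case True
  then obtain y where y: "y \<in> S1" "dH1 y \<le> 2" by blast
  have "{w \<in> S2. E y w} \<noteq> {}" "{w \<in> S3. E y w} \<noteq> {}"
    using S1_nbs[OF y(1) assms(1)] by auto
  then have "0 < card {w \<in> S2. E y w}" "0 < card {w \<in> S3. E y w}"
    using fins by (auto simp: card_gt_0_iff)
  then have "card {w \<in> S2. E y w} = 1" "card {w \<in> S3. E y w} = 1" using y(2) by linarith+
  then obtain u v where uv: "{w \<in> S2. E y w} = {u}" "{w \<in> S3. E y w} = {v}"
    by (meson card_1_singletonE)
  have B: "\<exists>a\<in>S1. E a p" if "p \<in> S2" for p
    using far1[of p] dis[of p] that assms sym unfolding cls by blast
  have C: "\<exists>a\<in>S1. E a p" if "p \<in> S3" for p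
    using far1[of p] dis[of p] that assms sym unfolding cls by blast
  have "2 * (card S1 + card S2 + card S3) \<le> e12 + e13 + e23 + 6"
    by (rule tripartite_degree2_edges_ge[OF fins(1-3) disj(1-3) sym tri S12 S13
        S1_nbs(1)[OF _ assms(1)] S1_nbs(2)[OF _ assms(1)] B C y(1) uv])
  then show ?thesis ..
next
  case False
  then have "3 \<le> dH1 y" if "y \<in> S1" for y using that by fastforce
  then have "(\<Sum>y\<in>S1. 3) \<le> (\<Sum>y\<in>S1. dH1 y)" by (rule sum_mono)
  then show ?thesis using fins by (simp add: sum.distrib cross_edges_eq_sum)
qed

end

section \<open>Lower bound for the edges inside U, using the cyclic symmetry\<close>

context maximal_triangle_free
begin

interpretation r: maximal_triangle_free U E n2 n3 n1 by (rule rot)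
interpretation q: maximal_triangle_free U E n3 n1 n2 by (rule r.rot)

lemma rot_sets:
  "r.S1 = S2" "r.S2 = S3" "r.S3 = S1" "r.T1 = T2" "r.T2 = T3" "r.T3 = T1" "r.F = F"
  "q.S1 = S3" "q.S2 = S1" "q.S3 = S2" "q.T1 = T3" "q.T2 = T1" "q.T3 = T2" "q.F = F"
  unfolding cls r.cls q.cls by auto

lemma rot_edges: "cross_edges E S2 S1 = e12" "cross_edges E S3 S1 = e13" "cross_edges E S3 S2 = e23"
  using cross_edges_commute[of E, OF sym] by blast+

lemmas r_facts = r.H_ge1 r.H_ge2 r.e_ge r.T1_pos r.S_pos r.T1_ge2 r.sum_d_S1 r.sum_d_T1 r.S1_dichotomy
lemmas q_facts = q.H_ge1 q.H_ge2 q.e_ge q.T1_pos q.S_pos q.T1_ge2 q.sum_d_S1 q.sum_d_T1 q.S1_dichotomy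
lemmas rotated_facts = r_facts[unfolded rot_sets rot_edges]
lemmas rotated2_facts = q_facts[unfolded rot_sets rot_edges]

lemma sum_d: "(\<Sum>v\<in>U. d v) = 2 * (e12 + e13 + e23
    + card S1 * card T1 + card S2 * card T2 + card S3 * card T3)"
  unfolding sum_U sum_d_S1 sum_d_T1 rotated_facts rotated2_facts sum_d_F by simp

lemma weight_sum:
  "(\<Sum>v\<in>U. (2 * (of_bool (n1 v) + of_bool (n2 v) + of_bool (n3 v)) - 4 :: int))
    = 2 * int (card F) - 2 * int (card S1 + card S2 + card S3)"
proof -
  let ?g = "\<lambda>v. 2 * (of_bool (n1 v) + of_bool (n2 v) + of_bool (n3 v)) - 4 :: int"
  have "sum ?g S1 = - 2 * int (card S1)" "sum ?g S2 = - 2 * int (card S2)"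
    "sum ?g S3 = - 2 * int (card S3)" "sum ?g T1 = 0" "sum ?g T2 = 0" "sum ?g T3 = 0"
    "sum ?g F = 2 * int (card F)"
    by (simp_all add: cls)
  then show ?thesis unfolding sum_U by simp
qed

text \<open>Expansions of \<open>(s - 1) * (t - 1) >= 0\<close> and
  \<open>(s - 1) * (t - 2) >= 0\<close>; they replace products of class sizes by linear
  terms.\<close>

lemma mult_ge:
  fixes s t :: nat
  shows "s = 0 \<or> t = 0 \<or> s + t \<le> s * t + 1"
    and "s = 0 \<or> t \<le> 1 \<or> 2 * s + t \<le> s * t + 2"
proof -
  show "s = 0 \<or> t = 0 \<or> s + t \<le> s * t + 1"
    by (cases s; cases t) auto
  show "s = 0 \<or> t \<le> 1 \<or> 2 * s + t \<le> s * t + 2"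
    by (cases s; cases t; cases "t - 1") simp_all
qed

text \<open>Write s for the total size of the S classes and e for the edges between them. If
  \<open>e >= 2 * s - 6\<close>, then \<open>s + card F >= 10\<close> yields exactly the required
  margin. Otherwise the dichotomy gives degree sums at least three times the size for all three
  classes, and adding them gives \<open>2 * e >= 3 * s\<close>.\<close>

lemma edges_no_pairs:
  assumes "T1 = {}" "T2 = {}" "T3 = {}"
  shows "card S1 + card S2 + card S3 + 3 < card F + (e12 + e13 + e23)"
proof (cases "S1 = {} \<and> S2 = {} \<and> S3 = {}")
  case True
  then show ?thesis using card_U U10 assms by simp
next
  case False
  then have ne: "S1 \<noteq> {}" "S2 \<noteq> {}" "S3 \<noteq> {}"
    using S_pos rotated_facts(6) rotated2_facts(6) assms by metis+
  have F: "10 \<le> card S1 + card S2 + card S3 + card F"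
    using card_U U10 assms by simp
  show ?thesis
  proof (cases "2 * (card S1 + card S2 + card S3) \<le> e12 + e13 + e23 + 6")
    case True
    then show ?thesis using F by simp
  next
    case False
    then have "3 * card S1 \<le> e12 + e13" "3 * card S2 \<le> e23 + e12" "3 * card S3 \<le> e13 + e23"
      using S1_dichotomy[OF assms] rotated_facts(10)[OF assms(2,3,1)] rotated2_facts(10)[OF assms(3,1,2)]
      by (simp_all add: ac_simps)
    then show ?thesis using F by simp
  qed
qed

text \<open>The variables \<open>m1\<close>, \<open>m2\<close>, \<open>m3\<close> stand for the
  products \<open>s1 * t1\<close>, \<open>s2 * t2\<close>, \<open>s3 * t3\<close>. Once it is fixed
  which sizes vanish, everything is linear.\<close>

lemma edges_arith:
  fixes s1 s2 s3 t1 t2 t3 f a b c m1 m2 m3 :: nat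
  assumes "10 \<le> s1 + s2 + s3 + t1 + t2 + t3 + f"
    and "t1 = 0 \<or> 0 < s1" "t2 = 0 \<or> 0 < s2" "t3 = 0 \<or> 0 < s3"
    and "s1 = 0 \<or> 0 < t1 \<or> 0 < s2 \<and> 0 < s3" "s2 = 0 \<or> 0 < t2 \<or> 0 < s3 \<and> 0 < s1"
      "s3 = 0 \<or> 0 < t3 \<or> 0 < s1 \<and> 0 < s2"
    and "s1 = 0 \<or> 0 < s2 \<or> 0 < s3 \<or> 2 \<le> t1" "s2 = 0 \<or> 0 < s3 \<or> 0 < s1 \<or> 2 \<le> t2"
      "s3 = 0 \<or> 0 < s1 \<or> 0 < s2 \<or> 2 \<le> t3"
    and "s1 = 0 \<or> s2 = 0 \<and> s3 = 0 \<or> s1 + s2 + s3 \<le> a + b + c + 1"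
      "s2 = 0 \<or> s3 = 0 \<and> s1 = 0 \<or> s1 + s2 + s3 \<le> a + b + c + 1"
      "s3 = 0 \<or> s1 = 0 \<and> s2 = 0 \<or> s1 + s2 + s3 \<le> a + b + c + 1"
    and "s1 = 0 \<or> 0 < t1 \<or> 2 * s1 + s2 + s3 \<le> a + b + c + 2"
      "s2 = 0 \<or> 0 < t2 \<or> 2 * s2 + s3 + s1 \<le> a + b + c + 2"
      "s3 = 0 \<or> 0 < t3 \<or> 2 * s3 + s1 + s2 \<le> a + b + c + 2"
    and "0 < t1 \<or> s1 \<le> a \<and> s1 \<le> b" "0 < t2 \<or> s2 \<le> a \<and> s2 \<le> c" "0 < t3 \<or> s3 \<le> b \<and> s3 \<le> c"
    and "s1 = 0 \<or> t1 = 0 \<or> s1 + t1 \<le> m1 + 1" "s2 = 0 \<or> t2 = 0 \<or> s2 + t2 \<le> m2 + 1"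
      "s3 = 0 \<or> t3 = 0 \<or> s3 + t3 \<le> m3 + 1"
    and "s1 = 0 \<or> t1 \<le> 1 \<or> 2 * s1 + t1 \<le> m1 + 2" "s2 = 0 \<or> t2 \<le> 1 \<or> 2 * s2 + t2 \<le> m2 + 2"
      "s3 = 0 \<or> t3 \<le> 1 \<or> 2 * s3 + t3 \<le> m3 + 2"
    and "0 < t1 \<or> 0 < t2 \<or> 0 < t3"
  shows "s1 + s2 + s3 + 3 < f + (a + b + c) + (m1 + m2 + m3)"
  using assms
  by - (cases "t1 = 0"; cases "t2 = 0"; cases "t3 = 0"; cases "s1 = 0"; cases "s2 = 0"; cases "s3 = 0"; simp)

text \<open>By \<open>weight_sum\<close> and \<open>sum_d\<close> this is \<open>weight_gt\<close>
  divided by 2.\<close>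

lemma edges_gt:
  "card S1 + card S2 + card S3 + 3 < card F + (e12 + e13 + e23)
    + (card S1 * card T1 + card S2 * card T2 + card S3 * card T3)"
proof (cases "T1 = {} \<and> T2 = {} \<and> T3 = {}")
  case True
  then show ?thesis using edges_no_pairs by simp
next
  case False
  have z: "card A = 0 \<longleftrightarrow> A = {}" "0 < card A \<longleftrightarrow> A \<noteq> {}"
    if "A \<in> {S1, S2, S3, T1, T2, T3}" for A
    using fins that by (auto simp: card_gt_0_iff)
  have zs: "card S1 = 0 \<longleftrightarrow> S1 = {}" "card S2 = 0 \<longleftrightarrow> S2 = {}" "card S3 = 0 \<longleftrightarrow> S3 = {}"
    "card T1 = 0 \<longleftrightarrow> T1 = {}" "card T2 = 0 \<longleftrightarrow> T2 = {}" "card T3 = 0 \<longleftrightarrow> T3 = {}"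
    "0 < card S1 \<longleftrightarrow> S1 \<noteq> {}" "0 < card S2 \<longleftrightarrow> S2 \<noteq> {}" "0 < card S3 \<longleftrightarrow> S3 \<noteq> {}"
    "0 < card T1 \<longleftrightarrow> T1 \<noteq> {}" "0 < card T2 \<longleftrightarrow> T2 \<noteq> {}" "0 < card T3 \<longleftrightarrow> T3 \<noteq> {}"
    by (rule z; simp)+
  show ?thesis
  proof (rule edges_arith[where ?t1.0 = "card T1" and ?t2.0 = "card T2" and ?t3.0 = "card T3"], goal_cases)
    case 1 then show ?case using card_U U10 by simp
  next
    case 2 then show ?case using T1_pos zs by blast
  next
    case 3 then show ?case using rotated_facts(5) zs by blast
  next
    case 4 then show ?case using rotated2_facts(5) zs by blast
  next
    case 5 then show ?case using S_pos zs by blast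
  next
    case 6 then show ?case using rotated_facts(6) zs by blast
  next
    case 7 then show ?case using rotated2_facts(6) zs by blast
  next
    case 8 then show ?case using T1_ge2 zs by blast
  next
    case 9 then show ?case using rotated_facts(7) zs by blast
  next
    case 10 then show ?case using rotated2_facts(7) zs by blast
  next
    case 11 then show ?case using H_ge1 zs by blast
  next
    case 12 then show ?case using rotated_facts(1) zs by (simp add: ac_simps) blast
  next
    case 13 then show ?case using rotated2_facts(1) zs by (simp add: ac_simps) blast
  next
    case 14 
    have "2 * (card S1 - 1) + card S2 + card S3 \<le> e12 + e13 + e23" if "S1 \<noteq> {}" "T1 = {}"
      using H_ge2 that by blast
    then show ?case using zs by (cases "card S1") auto
  next
    case 15
    have "2 * (card S2 - 1) + card S3 + card S1 \<le> e23 + e12 + e13" if "S2 \<noteq> {}" "T2 = {}"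
      using rotated_facts(2) that by blast
    then show ?case using zs by (cases "card S2") auto
  next
    case 16
    have "2 * (card S3 - 1) + card S1 + card S2 \<le> e13 + e23 + e12" if "S3 \<noteq> {}" "T3 = {}"
      using rotated2_facts(2) that by blast
    then show ?case using zs by (cases "card S3") auto
  next
    case 17 then show ?case using e_ge zs by blast
  next
    case 18 then show ?case using rotated_facts(3,4) zs by blast
  next
    case 19 then show ?case using rotated2_facts(3,4) zs by blast
  next
    case 26 then show ?case using False zs by blast
  qed (rule mult_ge)+
qed

text \<open>The star itself contributes 6 to \<open>excess\<close>, so more than 6 from U is what
  makes \<open>excess\<close> exceed 12.\<close>

lemma weight_gt:
  "(\<Sum>v\<in>U. 2 * (of_bool (n1 v) + of_bool (n2 v) + of_bool (n3 v)) + int (d v) - 4) > 6"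
proof -
  have "(\<Sum>v\<in>U. 2 * (of_bool (n1 v) + of_bool (n2 v) + of_bool (n3 v)) + int (d v) - 4)
    = (\<Sum>v\<in>U. (2 * (of_bool (n1 v) + of_bool (n2 v) + of_bool (n3 v)) - 4 :: int))
      + int (\<Sum>v\<in>U. d v)"
    by (simp add: sum.distrib sum_subtractf)
  moreover have "int (card S1 + card S2 + card S3 + 3) < int (card F + (e12 + e13 + e23)
      + (card S1 * card T1 + card S2 * card T2 + card S3 * card T3))"
    using edges_gt by (simp only: of_nat_less_iff)
  ultimately show ?thesis unfolding weight_sum sum_d by simp
qed

end

section \<open>Counting triangles around a vertex of degree 4\<close>

text \<open>Saturation enters as \<open>sat\<close>: a new edge completes a \<open>K4\<close> only
  if its ends have two adjacent common neighbours. The neighbours of \<open>x\<close> are named so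
  that each shape of \<open>G[N(x)]\<close> need be treated for one labelling only.\<close>

locale K4_saturated_graph =
  fixes V :: "'a set" and E :: "'a \<Rightarrow> 'a \<Rightarrow> bool" and x a b c d :: 'a
  assumes finV: "finite V"
    and E_V: "\<And>u v. E u v \<Longrightarrow> u \<in> V"
    and sym: "\<And>u v. E u v \<Longrightarrow> E v u"
    and irr: "\<And>u. \<not> E u u"
    and K4: "\<And>p q r s. E p q \<Longrightarrow> E p r \<Longrightarrow> E p s \<Longrightarrow> E q r \<Longrightarrow> E q s \<Longrightarrow> E r s \<Longrightarrow> False"
    and sat: "\<And>u v. u \<in> V \<Longrightarrow> v \<in> V \<Longrightarrow> u \<noteq> v \<Longrightarrow> \<not> E u v \<Longrightarrow>
      \<exists>p q. E p q \<and> E u p \<and> E u q \<and> E v p \<and> E v q"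
    and deg: "\<And>v. v \<in> V \<Longrightarrow> 4 \<le> card {w. E v w}"
    and V15: "15 \<le> card V"
    and nx: "\<And>w. E x w \<longleftrightarrow> w = a \<or> w = b \<or> w = c \<or> w = d"
    and dist: "distinct [a, b, c, d]"
begin

definition "U = {u \<in> V. u \<noteq> x \<and> \<not> E x u}"

definition triangle_indicator :: "'a \<Rightarrow> 'a \<Rightarrow> 'a \<Rightarrow> nat" where
  "triangle_indicator p q r = of_bool (E p q \<and> E q r \<and> E p r)"

text \<open>Ordered triples are counted because the count is then additive and symmetric in the three sets;
  each triangle inside a set is counted 6 times.\<close>

definition triples :: "'a set \<Rightarrow> 'a set \<Rightarrow> 'a set \<Rightarrow> nat" where
  "triples I J K = (\<Sum>p\<in>I. \<Sum>q\<in>J. \<Sum>r\<in>K. triangle_indicator p q r)"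

definition triangles :: "'a set set" where
  "triangles = {S. S \<subseteq> V \<and> card S = 3 \<and> (\<forall>u\<in>S. \<forall>v\<in>S. u \<noteq> v \<longrightarrow> E u v)}"

definition root_edges :: nat where
  "root_edges = of_bool (E a b) + of_bool (E a c) + of_bool (E a d)
    + of_bool (E b c) + of_bool (E b d) + of_bool (E c d)"

definition nbhd_edges :: "'a \<Rightarrow> nat" where
  "nbhd_edges u = of_bool (E u a \<and> E u b \<and> E a b) + of_bool (E u a \<and> E u c \<and> E a c)
    + of_bool (E u a \<and> E u d \<and> E a d) + of_bool (E u b \<and> E u c \<and> E b c)
    + of_bool (E u b \<and> E u d \<and> E b d) + of_bool (E u c \<and> E u d \<and> E c d)"

definition shared :: "'a \<Rightarrow> 'a \<Rightarrow> nat" where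
  "shared u v = of_bool (E u a \<and> E v a) + of_bool (E u b \<and> E v b)
    + of_bool (E u c \<and> E v c) + of_bool (E u d \<and> E v d)"

text \<open>Summed over U, this counts every triangle with exactly two vertices in U twice, once
  from each of them; hence the factor 2 on the other terms of \<open>excess\<close>.\<close>

definition weight :: "'a \<Rightarrow> nat" where
  "weight u = (\<Sum>v | v \<in> U \<and> E u v. shared u v)"

text \<open>Up to a factor of 2, the surplus over \<open>2 (n - 5)\<close> of the triangles that meet \<open>N[x]\<close>; the bound
  \<open>2 n - 4\<close> corresponds to \<open>excess = 12\<close>.\<close>

definition excess :: int where
  "excess = 2 * int root_edges + (\<Sum>u\<in>U. 2 * int (nbhd_edges u) + int (weight u) - 4)"

lemma E_sym: "E u v \<longleftrightarrow> E v u" using sym by blast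

lemma dist': "a \<noteq> b" "a \<noteq> c" "a \<noteq> d" "b \<noteq> c" "b \<noteq> d" "c \<noteq> d"
  using dist by auto

lemma x_nbrs: "E x a" "E x b" "E x c" "E x d" "E a x" "E b x" "E c x" "E d x"
  using nx sym by auto

lemma in_V: "x \<in> V" "a \<in> V" "b \<in> V" "c \<in> V" "d \<in> V"
  using x_nbrs E_V by blast+

lemma x_neq: "x \<noteq> a" "x \<noteq> b" "x \<noteq> c" "x \<noteq> d"
  using x_nbrs irr by auto

lemma finU: "finite U" unfolding U_def using finV by simp

lemma V_eq: "V = insert x {a, b, c, d} \<union> U"
  unfolding U_def using in_V nx by auto

lemma U_disj: "insert x {a, b, c, d} \<inter> U = {}"
  unfolding U_def using nx by auto

lemma card_V: "card V = card U + 5"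
proof -
  have "card (insert x {a, b, c, d} \<union> U) = card (insert x {a, b, c, d}) + card U"
    using finU U_disj by (intro card_Un_disjoint) auto
  moreover have "card (insert x {a, b, c, d}) = 5" using dist' x_neq by simp
  ultimately show ?thesis using V_eq by simp
qed

lemma card_U: "10 \<le> card U" using card_V V15 by simp

lemma UI: "v \<in> V \<Longrightarrow> v \<noteq> x \<Longrightarrow> v \<noteq> a \<Longrightarrow> v \<noteq> b \<Longrightarrow> v \<noteq> c \<Longrightarrow> v \<noteq> d \<Longrightarrow> v \<in> U"
  using V_eq by auto

lemma U_V: "u \<in> U \<Longrightarrow> u \<in> V" and U_x: "u \<in> U \<Longrightarrow> \<not> E x u" "u \<in> U \<Longrightarrow> \<not> E u x"
  and U_neq: "u \<in> U \<Longrightarrow> u \<noteq> x" "u \<in> U \<Longrightarrow> u \<noteq> a" "u \<in> U \<Longrightarrow> u \<noteq> b" "u \<in> U \<Longrightarrow> u \<noteq> c" "u \<in> U \<Longrightarrow> u \<noteq> d"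
  unfolding U_def using nx sym by auto

lemma nbr_cases:
  assumes "E u p" "u \<in> U" shows "p = a \<or> p = b \<or> p = c \<or> p = d \<or> p \<in> U"
  using UI[of p] E_V[OF sym[OF assms(1)]] assms U_x by blast

lemma tri3_perm: "triangle_indicator p q r = triangle_indicator q p r" "triangle_indicator p q r = triangle_indicator p r q"
  unfolding triangle_indicator_def using sym by (auto simp: of_bool_def)

lemma D_swap12: "triples I J K = triples J I K"
  unfolding triples_def by (subst sum.swap) (simp add: tri3_perm(1))

lemma D_swap23: "triples I J K = triples I K J"
proof -
  have "(\<Sum>q\<in>J. \<Sum>r\<in>K. triangle_indicator p q r) = (\<Sum>r\<in>K. \<Sum>q\<in>J. triangle_indicator p r q)" for p
    by (subst sum.swap) (intro sum.cong refl tri3_perm(2))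
  then show ?thesis unfolding triples_def by simp
qed

lemma D_Un:
  assumes "finite I" "finite I'" "I \<inter> I' = {}"
  shows "triples (I \<union> I') J K = triples I J K + triples I' J K"
  unfolding triples_def using assms by (rule sum.union_disjoint)

lemma D_cube:
  assumes "finite I" "finite J" "I \<inter> J = {}"
  shows "triples (I \<union> J) (I \<union> J) (I \<union> J) = triples I I I + 3 * triples J I I + 3 * triples J J I + triples J J J"
proof -
  note un = D_Un[OF assms]
  have 2: "triples K (I \<union> J) L = triples K I L + triples K J L" for K L
    using un[of K L] D_swap12 by metis
  have 3: "triples K L (I \<union> J) = triples K L I + triples K L J" for K L
    using 2[of K L] D_swap23 by metis
  have "triples I J I = triples J I I" "triples I I J = triples J I I" "triples I J J = triples J J I" "triples J I J = triples J J I"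
    using D_swap12 D_swap23 by metis+
  then show ?thesis by (simp add: un 2 3)
qed

lemma D_mono:
  assumes "finite I'" "finite J'" "finite K'" "I \<subseteq> I'" "J \<subseteq> J'" "K \<subseteq> K'"
  shows "triples I J K \<le> triples I' J' K'"
proof -
  have "triples I J K \<le> (\<Sum>p\<in>I. \<Sum>q\<in>J. \<Sum>r\<in>K'. triangle_indicator p q r)"
    unfolding triples_def using assms by (intro sum_mono sum_mono2) auto
  also have "\<dots> \<le> (\<Sum>p\<in>I. \<Sum>q\<in>J'. \<Sum>r\<in>K'. triangle_indicator p q r)"
    using assms by (intro sum_mono sum_mono2) auto
  also have "\<dots> \<le> triples I' J' K'"
    unfolding triples_def using assms by (intro sum_mono2) auto
  finally show ?thesis .
qed

lemma sum_pairs: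
  fixes g :: "'a \<Rightarrow> 'a \<Rightarrow> nat"
  assumes "\<And>p q. g p q = g q p" "\<And>p. g p p = 0"
  shows "(\<Sum>p\<in>{a, b, c, d}. \<Sum>q\<in>{a, b, c, d}. g p q)
    = 2 * (g a b + g a c + g a d + g b c + g b d + g c d)"
  using dist' by (simp add: assms(2) assms(1)[of b a] assms(1)[of c a] assms(1)[of d a]
      assms(1)[of c b] assms(1)[of d b] assms(1)[of d c])

lemma tri3_same: "triangle_indicator u p p = 0"
  unfolding triangle_indicator_def using irr by simp

lemma D_x: "triples {x} {a, b, c, d} {a, b, c, d} = 2 * root_edges"
proof -
  have "triples {x} {a, b, c, d} {a, b, c, d} = (\<Sum>p\<in>{a, b, c, d}. \<Sum>q\<in>{a, b, c, d}. triangle_indicator x p q)"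
    unfolding triples_def by simp
  also have "\<dots> = 2 * root_edges"
    by (subst sum_pairs, rule tri3_perm(2), rule tri3_same) (simp add: triangle_indicator_def root_edges_def x_nbrs)
  finally show ?thesis .
qed

lemma D_ee: "triples U {a, b, c, d} {a, b, c, d} = (\<Sum>u\<in>U. 2 * nbhd_edges u)"
proof -
  have t: "triangle_indicator u p q = of_bool (E u p \<and> E u q \<and> E p q)" for u p q
    unfolding triangle_indicator_def by (rule arg_cong[of _ _ of_bool]) blast
  show ?thesis unfolding triples_def
    by (rule sum.cong[OF refl], subst sum_pairs, rule tri3_perm(2), rule tri3_same)
      (simp only: t nbhd_edges_def)
qed

lemma D_W: "triples U U {a, b, c, d} = (\<Sum>u\<in>U. weight u)"
  unfolding triples_def
proof (rule sum.cong[OF refl])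
  fix u
  have "weight u = (\<Sum>v\<in>U. if E u v then shared u v else 0)"
    unfolding weight_def using finU by (simp add: sum.inter_filter)
  also have "\<dots> = (\<Sum>v\<in>U. \<Sum>r\<in>{a, b, c, d}. triangle_indicator u v r)"
    unfolding triangle_indicator_def shared_def using dist' by (intro sum.cong refl) (auto simp: of_bool_def)
  finally show "(\<Sum>v\<in>U. \<Sum>r\<in>{a, b, c, d}. triangle_indicator u v r) = weight u" by simp
qed

text \<open>The blocks of \<open>V = N[x] \<union> U\<close> are expanded by \<open>D_cube\<close>.
  A triangle through \<open>x\<close>, or one with a single vertex in U, has 6 orderings;
  \<open>weight\<close> gets only the factor 3 because its sum already counts twice.\<close>

lemma D_V_ge: "6 * root_edges + (\<Sum>u\<in>U. 6 * nbhd_edges u + 3 * weight u) + triples U U U \<le> triples V V V"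
proof -
  let ?N = "{a, b, c, d}" and ?M = "{x} \<union> {a, b, c, d}"
  have M: "triples ?M ?M ?M \<ge> 3 * triples {x} ?N ?N"
  proof -
    have "triples ({x} \<union> ?N) ({x} \<union> ?N) ({x} \<union> ?N) = triples (?N \<union> {x}) (?N \<union> {x}) (?N \<union> {x})"
      by (simp only: Un_commute)
    also have "\<dots> = triples ?N ?N ?N + 3 * triples {x} ?N ?N + 3 * triples {x} {x} ?N + triples {x} {x} {x}"
      using x_neq by (intro D_cube) auto
    finally show ?thesis by linarith
  qed
  have "triples V V V = triples ?M ?M ?M + 3 * triples U ?M ?M + 3 * triples U U ?M + triples U U U"
  proof -
    have "V = ?M \<union> U" using V_eq by auto
    moreover have "triples (?M \<union> U) (?M \<union> U) (?M \<union> U) = triples ?M ?M ?M + 3 * triples U ?M ?M + 3 * triples U U ?M + triples U U U"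
      using finU U_disj by (intro D_cube) auto
    ultimately show ?thesis by metis
  qed
  moreover have "triples U ?N ?N \<le> triples U ?M ?M" "triples U U ?N \<le> triples U U ?M"
    using finU by (intro D_mono; auto)+
  ultimately show ?thesis
    using M by (simp add: D_x D_ee D_W sum.distrib sum_distrib_left[symmetric])
qed

lemma D_le_triangles: "triples V V V \<le> 6 * card triangles"
proof -
  define Q where "Q = {(p, q, r). E p q \<and> E q r \<and> E p r}"
  have QV: "Q \<subseteq> V \<times> V \<times> V" unfolding Q_def using E_V sym by blast
  then have finQ: "finite Q" using finV by (auto intro: finite_subset)
  have "triples V V V = (\<Sum>t\<in>V \<times> V \<times> V. if t \<in> Q then 1 else 0)"
    unfolding triples_def triangle_indicator_def Q_def using finV
    by (simp add: sum.cartesian_product of_bool_def split_def)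
  also have "\<dots> = card Q"
    using QV finV by (simp add: sum.If_cases Int_absorb1)
  finally have 1: "triples V V V = card Q" .
  have finT: "finite triangles"
    unfolding triangles_def using finV by (auto intro: finite_subset[of _ "Pow V"])
  \<comment> \<open>\<open>Q\<close> is fibred over the underlying 3-sets, and a fibre has at most
    3! elements.\<close>
  let ?f = "\<lambda>S. {(p, q, r). (p, q, r) \<in> Q \<and> {p, q, r} = S}"
  have "Q \<subseteq> (\<Union>S\<in>triangles. ?f S)"
  proof
    fix t assume t: "t \<in> Q"
    then obtain p q r where [simp]: "t = (p, q, r)" and e: "E p q" "E q r" "E p r"
      unfolding Q_def by auto
    have "{p, q, r} \<in> triangles"
      unfolding triangles_def using e irr E_V[OF e(1)] E_V[OF e(2)] E_V[OF sym[OF e(2)]] sym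
      by (auto simp: card_insert_if)
    then show "t \<in> (\<Union>S\<in>triangles. ?f S)" using t by auto
  qed
  moreover have "finite (\<Union>S\<in>triangles. ?f S)"
    using finT finQ by (auto intro: finite_subset[of _ Q])
  ultimately have "card Q \<le> card (\<Union>S\<in>triangles. ?f S)" by (simp add: card_mono)
  also have "\<dots> \<le> (\<Sum>S\<in>triangles. card (?f S))"
    using finT by (rule card_UN_le)
  also have "\<dots> \<le> (\<Sum>S\<in>triangles. 6)"
  proof (rule sum_mono)
    fix S assume "S \<in> triangles"
    then have "card S = 3" unfolding triangles_def by simp
    then obtain p q r where S: "S = {p, q, r}" "p \<noteq> q" "p \<noteq> r" "q \<noteq> r"
      by (auto simp: card_3_iff)
    have "?f S \<subseteq> {(p,q,r),(p,r,q),(q,p,r),(q,r,p),(r,p,q),(r,q,p)}"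
    proof
      fix t assume "t \<in> ?f S"
      then obtain u v w where t: "t = (u, v, w)" "E u v" "E v w" "E u w" "{u, v, w} = S"
        unfolding Q_def by auto
      then have "u \<in> {p, q, r}" "v \<in> {p, q, r}" "w \<in> {p, q, r}" using S(1) by blast+
      moreover have "u \<noteq> v" "v \<noteq> w" "u \<noteq> w" using t irr by blast+
      ultimately show "t \<in> {(p,q,r),(p,r,q),(q,p,r),(q,r,p),(r,p,q),(r,q,p)}"
        unfolding t(1) by auto
    qed
    then have "card (?f S) \<le> card {(p,q,r),(p,r,q),(q,p,r),(q,r,p),(r,p,q),(r,q,p)}"
      by (intro card_mono) auto
    also have "\<dots> = 6" using S(2-4) by simp
    finally show "card (?f S) \<le> 6" .
  qed
  finally show ?thesis using 1 by simp
qed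

text \<open>The 60 is 12 times the five vertices of \<open>N[x]\<close>. With
  \<open>excess = 12\<close> the inequality reads
  \<open>card triangles >= 2 * card V - 4\<close>.\<close>

lemma triangles_ge:
  "3 * excess + int (triples U U U) + 12 * int (card V) \<le> 6 * int (card triangles) + 60"
proof -
  have "int (6 * root_edges + (\<Sum>u\<in>U. 6 * nbhd_edges u + 3 * weight u) + triples U U U) \<le> int (6 * card triangles)"
    using D_V_ge D_le_triangles by (simp only: of_nat_le_iff)
  moreover have "3 * excess + 12 * int (card U)
      = 6 * int root_edges + int (\<Sum>u\<in>U. 6 * nbhd_edges u + 3 * weight u)"
    unfolding excess_def by (simp add: sum.distrib sum_subtractf sum_distrib_left)
  ultimately show ?thesis using card_V by simp
qed

end

section \<open>Relabelling, and local consequences of saturation\<close>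

context K4_saturated_graph
begin

lemma permute:
  assumes "distinct [a', b', c', d']" "{a', b', c', d'} = {a, b, c, d}"
  shows "K4_saturated_graph V E x a' b' c' d'"
proof
  show "E x w \<longleftrightarrow> w = a' \<or> w = b' \<or> w = c' \<or> w = d'" for w
    using nx[of w] assms(2) by blast
qed (fact finV V15 assms(1) irr | erule E_V sym deg | erule (5) K4 | erule (3) sat)+

text \<open>Saturation for the non-adjacent pair \<open>x\<close>, \<open>u\<close>: the edge
  between common neighbours lies in N(x).\<close>

lemma U_edge:
  assumes "u \<in> U"
  obtains "E u a" "E u b" "E a b" | "E u a" "E u c" "E a c" | "E u a" "E u d" "E a d"
    | "E u b" "E u c" "E b c" | "E u b" "E u d" "E b d" | "E u c" "E u d" "E c d"
proof -
  obtain p q where "E p q" "E x p" "E x q" "E u p" "E u q"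
    using sat[of x u] in_V U_V[OF assms] U_x[OF assms] U_neq[OF assms] by auto
  then show ?thesis using that irr sym unfolding nx by blast
qed

lemma no_triangle: "E p q \<Longrightarrow> E q r \<Longrightarrow> E p r \<Longrightarrow> E x p \<Longrightarrow> E x q \<Longrightarrow> E x r \<Longrightarrow> False"
  using K4 by blast

lemma common_edge:
  assumes "u \<in> V" "v \<in> V" "u \<noteq> v" "\<not> E u v"
  obtains p q where "E p q" "E q p" "E u p" "E u q" "E v p" "E v q"
  using sat[OF assms] sym by blast

lemma nbr_of: "u \<in> V \<Longrightarrow> E u p \<Longrightarrow> p = x \<or> p = a \<or> p = b \<or> p = c \<or> p = d \<or> p \<in> U"
  using UI E_V sym by blast

lemma deg_U:
  assumes "u \<in> U"
  shows "4 \<le> of_bool (E u a) + of_bool (E u b) + of_bool (E u c) + of_bool (E u d)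
    + card {w \<in> U. E u w}"
proof -
  have eq: "{w. E u w} = {w \<in> {a, b, c, d}. E u w} \<union> {w \<in> U. E u w}"
    using nbr_cases[OF _ assms] by auto
  have "card {w. E u w} \<le> card {w \<in> {a, b, c, d}. E u w} + card {w \<in> U. E u w}"
    by (subst eq) (rule card_Un_le)
  moreover have "card {w \<in> {a, b, c, d}. E u w} = (\<Sum>w | w \<in> {a, b, c, d} \<and> E u w. 1)"
    by (rule card_eq_sum)
  moreover have "\<dots> = (\<Sum>w\<in>{a, b, c, d}. if E u w then 1 else 0)"
    by (rule sum.inter_filter) simp
  moreover have "\<dots> = of_bool (E u a) + of_bool (E u b) + of_bool (E u c) + of_bool (E u d)"
    using dist' by (simp add: of_bool_def)
  ultimately show ?thesis using deg[OF U_V[OF assms]] by linarith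
qed

lemma W_ge:
  assumes "N \<subseteq> U" "\<And>v. v \<in> N \<Longrightarrow> E u v"
  shows "sum (shared u) N \<le> weight u"
  unfolding weight_def using finU assms by (intro sum_mono2) auto

lemma W_ge2:
  assumes "N \<subseteq> U" "\<And>v. v \<in> N \<Longrightarrow> E u v" "\<And>v. v \<in> N \<Longrightarrow> shared u v = k"
    and "M \<subseteq> U" "\<And>v. v \<in> M \<Longrightarrow> E u v" "\<And>v. v \<in> M \<Longrightarrow> shared u v = l"
    and "N \<inter> M = {}"
  shows "k * card N + l * card M \<le> weight u"
proof -
  have "sum (shared u) (N \<union> M) = sum (shared u) N + sum (shared u) M"
    using finU assms by (intro sum.union_disjoint) (auto intro: finite_subset)
  moreover have "sum (shared u) N = k * card N" "sum (shared u) M = l * card M"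
    using assms by simp_all
  moreover have "sum (shared u) (N \<union> M) \<le> weight u" using assms(1,2,4,5) by (intro W_ge) auto
  ultimately show ?thesis by simp
qed

lemma W_ge1:
  assumes "v \<in> U" "E u v" shows "shared u v \<le> weight u"
  using W_ge[of "{v}" u] assms by simp

lemma not_isolated: "E a d \<or> E b d \<or> E c d"
proof (rule ccontr)
  assume n: "\<not> (E a d \<or> E b d \<or> E c d)"
  have *: "\<exists>p q. p \<in> U \<and> q \<in> U \<and> E p q \<and> E p d \<and> E q d \<and> E p j \<and> E q j"
    if j: "j \<in> {a, b, c}" for j
  proof -
    obtain p q where pq: "E p q" "E q p" "E d p" "E d q" "E j p" "E j q"
    proof (rule common_edge)
      show "d \<in> V" "j \<in> V" "d \<noteq> j" "\<not> E d j" using n j dist' in_V E_sym by auto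
    qed
    \<comment> \<open>As \<open>d\<close> is isolated in N(x), none of its neighbours lies there;
      and \<open>x\<close> as one end would put the other end into N(x).\<close>
    have "p \<notin> {a, b, c, d}" "q \<notin> {a, b, c, d}" using pq n irr sym by blast+
    moreover have "p \<noteq> x" "q \<noteq> x" using pq nx calculation by blast+
    ultimately have "p \<in> U" "q \<in> U"
      using nbr_of[OF in_V(5) pq(3)] nbr_of[OF in_V(5) pq(4)] by blast+
    then show ?thesis using pq sym by blast
  qed
  have t: "E u a \<and> E u b \<and> E a b \<or> E u a \<and> E u c \<and> E a c \<or> E u b \<and> E u c \<and> E b c"
    if "u \<in> U" for u
    using U_edge[OF that] n by metis
  have k: "\<not> (E a b \<and> E p a \<and> E p b \<and> E q a \<and> E q b)" "\<not> (E a c \<and> E p a \<and> E p c \<and> E q a \<and> E q c)"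
    "\<not> (E b c \<and> E p b \<and> E p c \<and> E q b \<and> E q c)" if "E p q" for p q
    using K4[OF that] by blast+
  have nt: "\<not> (E a b \<and> E b c \<and> E a c)" using no_triangle[of a b c] x_nbrs by blast
  obtain p q where "p \<in> U" "q \<in> U" "E p q" "E p a" "E q a" using *[of a] by blast
  note 1 = this(4,5) t[OF this(1)] t[OF this(2)] k[OF this(3)]
  obtain p' q' where "p' \<in> U" "q' \<in> U" "E p' q'" "E p' b" "E q' b" using *[of b] by blast
  note 2 = this(4,5) t[OF this(1)] t[OF this(2)] k[OF this(3)]
  obtain p'' q'' where "p'' \<in> U" "q'' \<in> U" "E p'' q''" "E p'' c" "E q'' c" using *[of c] by blast
  note 3 = this(4,5) t[OF this(1)] t[OF this(2)] k[OF this(3)]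
  \<comment> \<open>At most two of the pairs among a, b, c are edges. If these form a path and
    \<open>j\<close> is one of its ends, then \<open>p\<close> and \<open>q\<close> both see the
    middle and \<open>j\<close>, hence share an edge, against \<open>K4\<close>; a single edge is
    shared at once. All three values of \<open>j\<close> are supplied because the middle is not
    known.\<close>
  show False using 1 2 3 nt by argo
qed

lemma sum_of_bool_int:
  "(\<Sum>v\<in>U. k * of_bool (P v)) = (k::int) * int (card {v \<in> U. P v})"
  using finU by (simp add: sum_distrib_left[symmetric] Int_def)

section \<open>A path in the neighbourhood\<close>

lemma excess_P4:
  assumes e: "E a b" "E b c" "E c d" "\<not> E a c" "\<not> E a d" "\<not> E b d"
  shows "12 < excess"
proof -
  have e': "E b a" "E c b" "E d c" "\<not> E c a" "\<not> E d a" "\<not> E d b" using e sym by blast+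
  \<comment> \<open>\<open>pA\<close> and \<open>pC\<close> are the two types that see both ends of
    the path and just one inner vertex; \<open>pB\<close> sees only the middle edge. These are the
    types with \<open>nbhd_edges\<close> equal to 1, and they will turn out to be completely joined
    to each other.\<close>
  define pA where "pA v \<longleftrightarrow> E v a \<and> E v b \<and> \<not> E v c \<and> E v d" for v
  define pC where "pC v \<longleftrightarrow> E v a \<and> \<not> E v b \<and> E v c \<and> E v d" for v
  define pB where "pB v \<longleftrightarrow> \<not> E v a \<and> E v b \<and> E v c \<and> \<not> E v d" for v
  define pR where "pR v \<longleftrightarrow> \<not> pA v \<and> \<not> pB v \<and> \<not> pC v" for v
  note p = pA_def pB_def pC_def
  have t: "E u a \<and> E u b \<or> E u b \<and> E u c \<or> E u c \<and> E u d" if "u \<in> U" for u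
    using U_edge[OF that] e by metis
  have k: "\<not> (E u a \<and> E u b \<and> E v a \<and> E v b)" "\<not> (E u b \<and> E u c \<and> E v b \<and> E v c)"
    "\<not> (E u c \<and> E u d \<and> E v c \<and> E v d)" if "E u v" for u v
    using K4[OF that] e by blast+
  have tAB: "E u c \<or> E u d" if u: "u \<in> U" "E u a" for u
  proof (rule ccontr)
    assume n: "\<not> (E u c \<or> E u d)"
    then obtain p q where pq: "E p q" "E q p" "E u p" "E u q" "E d p" "E d q"
      using common_edge[of u d] U_V[OF u(1)] in_V U_neq[OF u(1)] by metis
    have pU: "p \<in> U" "q \<in> U"
      using nbr_cases[OF pq(3) u(1)] nbr_cases[OF pq(4) u(1)] pq n e e' by auto
    show False
      using t[OF pU(1)] t[OF pU(2)] t[OF u(1)] k[OF pq(1)] k[OF pq(3)] k[OF pq(4)] n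
        sym[OF pq(5)] sym[OF pq(6)] by argo
  qed
  have tCD: "E u b \<or> E u a" if u: "u \<in> U" "E u d" for u
  proof (rule ccontr)
    assume n: "\<not> (E u b \<or> E u a)"
    then obtain p q where pq: "E p q" "E q p" "E u p" "E u q" "E a p" "E a q"
      using common_edge[of u a] U_V[OF u(1)] in_V U_neq[OF u(1)] by metis
    have pU: "p \<in> U" "q \<in> U"
      using nbr_cases[OF pq(3) u(1)] nbr_cases[OF pq(4) u(1)] pq n e e' by auto
    show False
      using t[OF pU(1)] t[OF pU(2)] t[OF u(1)] k[OF pq(1)] k[OF pq(3)] k[OF pq(4)] n
        sym[OF pq(5)] sym[OF pq(6)] by argo
  qed
  \<comment> \<open>The adjacent common neighbours of a and d each see b or c; as they share neither
    ab nor cd, one sees only b and the other only c.\<close>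
  have ex: "(\<exists>v\<in>U. pA v) \<and> (\<exists>v\<in>U. pC v)"
  proof -
    obtain p q where pq: "E p q" "E q p" "E a p" "E a q" "E d p" "E d q"
      using common_edge[of a d] e in_V dist' by metis
    have pU: "p \<in> U" "q \<in> U"
      using nbr_of[OF in_V(2) pq(3)] nbr_of[OF in_V(2) pq(4)] pq e e' nx irr by auto
    have "pA p \<and> pC q \<or> pA q \<and> pC p"
      using t[OF pU(1)] t[OF pU(2)] k[OF pq(1)] sym[OF pq(3)] sym[OF pq(4)] sym[OF pq(5)]
        sym[OF pq(6)] unfolding p by argo
    then show ?thesis using pU by blast
  qed
  \<comment> \<open>The common neighbours of \<open>v\<close> and \<open>w\<close> are among a, d
    and the vertices of type \<open>pB\<close>, an independent set. \<open>AB\<close> and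
    \<open>CB\<close> follow the same pattern.\<close>
  have AC: "E v w" if vw: "v \<in> U" "w \<in> U" "pA v" "pC w" for v w
  proof (rule ccontr)
    assume n: "\<not> E v w"
    have "v \<noteq> w" using vw p by blast
    then obtain p q where pq: "E p q" "E q p" "E v p" "E v q" "E w p" "E w q"
      using common_edge[OF U_V[OF vw(1)] U_V[OF vw(2)] _ n] by metis
    have r: "r = a \<or> r = d \<or> pB r" if "E v r" "E w r" for r
      using nbr_cases[OF that(1) vw(1)] t[of r] k[OF that(1)] k[OF that(2)] that vw(3,4)
      by - (elim disjE; auto simp: p)
    show False
      using r[OF pq(3,5)] r[OF pq(4,6)] k[OF pq(1)] pq(1,2)
      by - (elim disjE; simp add: p e e' irr)
  qed
  have AB: "E v w" if vw: "v \<in> U" "w \<in> U" "pA v" "pB w" for v w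
  proof (rule ccontr)
    assume n: "\<not> E v w"
    have "v \<noteq> w" using vw p by blast
    then obtain p q where pq: "E p q" "E q p" "E v p" "E v q" "E w p" "E w q"
      using common_edge[OF U_V[OF vw(1)] U_V[OF vw(2)] _ n] by metis
    have r: "r = b \<or> E r c \<and> E r d \<and> \<not> E r b" if "E v r" "E w r" for r
      using nbr_cases[OF that(1) vw(1)] t[of r] k[OF that(1)] k[OF that(2)] that vw(3,4)
      by - (elim disjE; auto simp: p)
    show False
      using r[OF pq(3,5)] r[OF pq(4,6)] k[OF pq(1)] pq(1,2)
      by - (elim disjE; simp add: p e e' irr)
  qed
  have CB: "E v w" if vw: "v \<in> U" "w \<in> U" "pC v" "pB w" for v w
  proof (rule ccontr)
    assume n: "\<not> E v w"
    have "v \<noteq> w" using vw p by blast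
    then obtain p q where pq: "E p q" "E q p" "E v p" "E v q" "E w p" "E w q"
      using common_edge[OF U_V[OF vw(1)] U_V[OF vw(2)] _ n] by metis
    have r: "r = c \<or> E r a \<and> E r b \<and> \<not> E r c" if "E v r" "E w r" for r
      using nbr_cases[OF that(1) vw(1)] t[of r] k[OF that(1)] k[OF that(2)] that vw(3,4)
      by - (elim disjE; auto simp: p)
    show False
      using r[OF pq(3,5)] r[OF pq(4,6)] k[OF pq(1)] pq(1,2)
      by - (elim disjE; simp add: p e e' irr)
  qed
  have CA: "E v w" if "v \<in> U" "w \<in> U" "pC v" "pA w" for v w
    using sym[OF AC] that by blast
  have BA: "E v w" if "v \<in> U" "w \<in> U" "pB v" "pA w" for v w
    using sym[OF AB] that by blast
  have BC: "E v w" if "v \<in> U" "w \<in> U" "pB v" "pC w" for v w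
    using sym[OF CB] that by blast
  define nA where "nA = card {v \<in> U. pA v}"
  define nB where "nB = card {v \<in> U. pB v}"
  define nC where "nC = card {v \<in> U. pC v}"
  define nR where "nR = card {v \<in> U. pR v}"
  have "nA > 0" "nC > 0"
    unfolding nA_def nC_def using ex finU by (auto simp: card_gt_0_iff)
  have WA: "2 * nC + nB \<le> weight v" if "v \<in> U" "pA v" for v
  proof -
    have "2 * nC + 1 * nB \<le> weight v" unfolding nB_def nC_def using that AC AB
      by (intro W_ge2) (auto simp: p shared_def)
    then show ?thesis by simp
  qed
  have WC: "2 * nA + nB \<le> weight v" if "v \<in> U" "pC v" for v
  proof -
    have "2 * nA + 1 * nB \<le> weight v" unfolding nB_def nA_def using that CA CB
      by (intro W_ge2) (auto simp: p shared_def)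
    then show ?thesis by simp
  qed
  have WB: "nA + nC \<le> weight v" if "v \<in> U" "pB v" for v
  proof -
    have "1 * nA + 1 * nC \<le> weight v" unfolding nC_def nA_def using that BA BC
      by (intro W_ge2) (auto simp: p shared_def)
    then show ?thesis by simp
  qed
  \<comment> \<open>Type abcd sees three edges of the path. Types abc and bcd see two, and minimum
    degree 4 gives them a neighbour in U, with which they share at least two vertices of
    N(x).\<close>
  have WR: "6 \<le> 2 * nbhd_edges v + weight v" if v: "v \<in> U" "pR v" for v
  proof (cases "E v a \<and> E v b \<and> E v c \<and> E v d")
    case True
    then show ?thesis by (simp add: nbhd_edges_def e)
  next
    case False
    then have vt: "E v a \<and> E v b \<and> E v c \<and> \<not> E v d \<or> \<not> E v a \<and> E v b \<and> E v c \<and> E v d"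
      using v(2) t[OF v(1)] tAB[OF v(1)] tCD[OF v(1)] unfolding pR_def p by argo
    then have "nbhd_edges v = 2" by (elim disjE) (simp_all add: nbhd_edges_def e)
    have "{w \<in> U. E v w} \<noteq> {}"
    proof
      assume "{w \<in> U. E v w} = {}"
      then have "card {w \<in> U. E v w} = 0" by (simp only: card.empty)
      then show False using deg_U[OF v(1)] vt by - (elim disjE; simp)
    qed
    then obtain w where w: "w \<in> U" "E v w" by auto
    have "E v a \<and> E w a \<and> E v c \<and> E w c \<or> E v b \<and> E w b \<and> E v d \<and> E w d"
      using vt t[OF w(1)] tAB[OF w(1)] tCD[OF w(1)] k[OF w(2)] by argo
    then have "2 \<le> shared v w" by (auto simp: shared_def)
    then show ?thesis using W_ge1[OF w] \<open>nbhd_edges v = 2\<close> by linarith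
  qed
  have "(\<Sum>v\<in>U. (2 * int nC + int nB - 2) * of_bool (pA v) + (2 * int nA + int nB - 2) * of_bool (pC v)
     + (int nA + int nC - 2) * of_bool (pB v) + 2 * of_bool (pR v))
    \<le> (\<Sum>v\<in>U. 2 * int (nbhd_edges v) + int (weight v) - 4)"
  proof (rule sum_mono)
    fix v assume v: "v \<in> U"
    consider "pA v" | "pB v" | "pC v" | "pR v" unfolding pR_def by blast
    then show "(2 * int nC + int nB - 2) * of_bool (pA v) + (2 * int nA + int nB - 2) * of_bool (pC v)
       + (int nA + int nC - 2) * of_bool (pB v) + 2 * of_bool (pR v) \<le> 2 * int (nbhd_edges v) + int (weight v) - 4"
    proof cases
      case 1
      then have "\<not> pB v" "\<not> pC v" "\<not> pR v" "nbhd_edges v = 1" by (auto simp: pR_def p nbhd_edges_def e)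
      then show ?thesis using WA[OF v 1] 1 by simp
    next
      case 2
      then have "\<not> pA v" "\<not> pC v" "\<not> pR v" "nbhd_edges v = 1" by (auto simp: pR_def p nbhd_edges_def e)
      then show ?thesis using WB[OF v 2] 2 by simp
    next
      case 3
      then have "\<not> pB v" "\<not> pA v" "\<not> pR v" "nbhd_edges v = 1" by (auto simp: pR_def p nbhd_edges_def e)
      then show ?thesis using WC[OF v 3] 3 by simp
    next
      case 4
      then have "\<not> pB v" "\<not> pC v" "\<not> pA v" by (auto simp: pR_def)
      then show ?thesis using WR[OF v 4] 4 by simp
    qed
  qed
  then have 1: "(2 * int nC + int nB - 2) * int nA + (2 * int nA + int nB - 2) * int nC
     + (int nA + int nC - 2) * int nB + 2 * int nR \<le> excess - 6"
    unfolding excess_def sum.distrib sum_of_bool_int nA_def nB_def nC_def nR_def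
    by (simp add: root_edges_def e)
  have "(\<Sum>v\<in>U. 1 * of_bool (pA v) + 1 * of_bool (pB v) + 1 * of_bool (pC v) + 1 * of_bool (pR v))
    = (\<Sum>v\<in>U. 1 :: int)"
    by (rule sum.cong) (auto simp: pR_def p)
  then have 2: "int nA + int nB + int nC + int nR = int (card U)"
    unfolding sum.distrib sum_of_bool_int nA_def nB_def nC_def nR_def by simp
  \<comment> \<open>After this shift by 1 all coefficients in the expanded bound are nonnegative,
    and the linear part alone gives \<open>excess >= 2 * card U + 2\<close>.\<close>
  obtain a' where a': "int nA = 1 + int a'" using \<open>nA > 0\<close> by (metis Suc_pred of_nat_Suc)
  obtain c' where c': "int nC = 1 + int c'" using \<open>nC > 0\<close> by (metis Suc_pred of_nat_Suc)
  define X Y Z where XYZ: "X = int a' * int c'" "Y = int nB * int a'" "Z = int nB * int c'"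
  have "6 + 2 * int a' + 2 * int c' + 2 * int nB + 2 * int nR + 4 * X + 2 * Y + 2 * Z \<le> excess"
    using 1 unfolding a' c' XYZ by (simp add: algebra_simps)
  moreover have "0 \<le> X" "0 \<le> Y" "0 \<le> Z" unfolding XYZ by simp_all
  ultimately show ?thesis using 2 a' c' card_U by linarith
qed

end

section \<open>A cycle in the neighbourhood\<close>

locale K4_saturated_C4 = K4_saturated_graph +
  assumes cyc: "E a b" "E b c" "E c d" "E d a" "\<not> E a c" "\<not> E b d"
begin

lemma cyc': "E b a" "E c b" "E d c" "E a d" "\<not> E c a" "\<not> E d b"
  using cyc sym by blast+

text \<open>Rotating the cycle reduces work on the four classes to \<open>AB\<close> and to the pair
  \<open>AB\<close>, \<open>BC\<close>.\<close>

lemma rotate: "K4_saturated_C4 V E x b c d a"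
proof -
  interpret r: K4_saturated_graph V E x b c d a
    using dist by (intro permute) auto
  show ?thesis by unfold_locales (use cyc cyc' in blast)+
qed

definition "AB = {v \<in> U. E v a \<and> E v b \<and> \<not> E v c \<and> \<not> E v d}"
definition "BC = {v \<in> U. \<not> E v a \<and> E v b \<and> E v c \<and> \<not> E v d}"
definition "CD = {v \<in> U. \<not> E v a \<and> \<not> E v b \<and> E v c \<and> E v d}"
definition "DA = {v \<in> U. E v a \<and> \<not> E v b \<and> \<not> E v c \<and> E v d}"
text \<open>On a 4-cycle, \<open>nbhd_edges\<close> is 2 exactly for vertices seeing three of a, b,
  c, d and 4 for those seeing all; the value 3 does not occur.\<close>

definition "T = {v \<in> U. nbhd_edges v = 2}"
definition "F = {v \<in> U. nbhd_edges v = 4}"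

lemmas cls = AB_def BC_def CD_def DA_def

lemma mm_eq: "root_edges = 4" unfolding root_edges_def using cyc cyc' by simp

lemma ee_eq: "nbhd_edges u = of_bool (E u a \<and> E u b) + of_bool (E u a \<and> E u d)
    + of_bool (E u b \<and> E u c) + of_bool (E u c \<and> E u d)"
  unfolding nbhd_edges_def using cyc cyc' by simp

lemma types: "u \<in> U \<Longrightarrow> E u a \<and> E u b \<or> E u b \<and> E u c \<or> E u c \<and> E u d \<or> E u a \<and> E u d"
  using U_edge[of u] cyc by metis

lemma no_shared:
  assumes "E u v"
  shows "\<not> (E u a \<and> E u b \<and> E v a \<and> E v b)" "\<not> (E u b \<and> E u c \<and> E v b \<and> E v c)"
    "\<not> (E u c \<and> E u d \<and> E v c \<and> E v d)" "\<not> (E u a \<and> E u d \<and> E v a \<and> E v d)"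
  using K4[OF assms] cyc cyc' by blast+

lemma ee_cls: "v \<in> AB \<Longrightarrow> nbhd_edges v = 1" "v \<in> BC \<Longrightarrow> nbhd_edges v = 1" "v \<in> CD \<Longrightarrow> nbhd_edges v = 1" "v \<in> DA \<Longrightarrow> nbhd_edges v = 1"
  unfolding cls ee_eq by auto

lemma U_cls: "U = AB \<union> BC \<union> CD \<union> DA \<union> T \<union> F"
proof
  show "U \<subseteq> AB \<union> BC \<union> CD \<union> DA \<union> T \<union> F"
  proof
    fix u assume u: "u \<in> U"
    show "u \<in> AB \<union> BC \<union> CD \<union> DA \<union> T \<union> F"
      using types[OF u] u unfolding cls T_def F_def ee_eq by (auto simp: of_bool_def)
  qed
qed (auto simp: cls T_def F_def)

text \<open>Saturation for \<open>v\<close> and c: if one of the two adjacent common neighbours is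
  b, the other sees b and c; if not, they cannot both see cd, so one of them sees bc. It misses a
  because it may not share ab with \<open>v\<close>. The second claim is the mirror image, with d in
  place of c.\<close>

lemma AB_nbrs:
  assumes v: "v \<in> AB"
  shows "\<exists>w\<in>U. E v w \<and> E w b \<and> E w c \<and> \<not> E w a" "\<exists>w\<in>U. E v w \<and> E w a \<and> E w d \<and> \<not> E w b"
proof -
  have vU: "v \<in> U" and v': "E v a" "E v b" "\<not> E v c" "\<not> E v d" using v by (auto simp: cls)
  show "\<exists>w\<in>U. E v w \<and> E w b \<and> E w c \<and> \<not> E w a"
  proof -
    obtain p q where pq: "E p q" "E q p" "E v p" "E v q" "E c p" "E c q"
      using common_edge[of v c] U_V[OF vU] in_V U_neq[OF vU] v' by metis
    have r: "r = b \<or> r \<in> U \<and> E r c \<and> (E r b \<and> \<not> E r a \<or> E r d)" if "E v r" "E c r" for r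
      using nbr_cases[OF that(1) vU] types[of r] no_shared[OF that(1)] that v' sym[OF that(2)] cyc cyc'
      by auto
    have "(p \<in> U \<and> E v p \<and> E p b \<and> E p c \<and> \<not> E p a) \<or> (q \<in> U \<and> E v q \<and> E q b \<and> E q c \<and> \<not> E q a)"
    proof (cases "p = b \<or> q = b")
      case True
      then have "p = b \<and> q \<noteq> b \<and> E q b \<or> q = b \<and> p \<noteq> b \<and> E p b"
        using pq(1,2) irr by auto
      then show ?thesis
        using r[OF pq(3,5)] r[OF pq(4,6)] no_shared(1)[OF pq(3)] no_shared(1)[OF pq(4)] pq(3,4) v'
        by argo
    next
      case False
      then show ?thesis
        using r[OF pq(3,5)] r[OF pq(4,6)] no_shared(3)[OF pq(1)] pq(3,4) by argo
    qed
    then show ?thesis by blast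
  qed
  show "\<exists>w\<in>U. E v w \<and> E w a \<and> E w d \<and> \<not> E w b"
  proof -
    obtain p q where pq: "E p q" "E q p" "E v p" "E v q" "E d p" "E d q"
      using common_edge[of v d] U_V[OF vU] in_V U_neq[OF vU] v' by metis
    have r: "r = a \<or> r \<in> U \<and> E r d \<and> (E r a \<and> \<not> E r b \<or> E r c)" if "E v r" "E d r" for r
      using nbr_cases[OF that(1) vU] types[of r] no_shared[OF that(1)] that v' sym[OF that(2)] cyc cyc'
      by auto
    have "(p \<in> U \<and> E v p \<and> E p a \<and> E p d \<and> \<not> E p b) \<or> (q \<in> U \<and> E v q \<and> E q a \<and> E q d \<and> \<not> E q b)"
    proof (cases "p = a \<or> q = a")
      case True
      then have "p = a \<and> q \<noteq> a \<and> E q a \<or> q = a \<and> p \<noteq> a \<and> E p a"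
        using pq(1,2) irr by auto
      then show ?thesis
        using r[OF pq(3,5)] r[OF pq(4,6)] no_shared(1)[OF pq(3)] no_shared(1)[OF pq(4)] pq(3,4) v'
        by argo
    next
      case False
      then show ?thesis
        using r[OF pq(3,5)] r[OF pq(4,6)] no_shared(3)[OF pq(1)] pq(3,4) by argo
    qed
    then show ?thesis by blast
  qed
qed

lemma AB_W: "v \<in> AB \<Longrightarrow> 2 \<le> weight v"
proof -
  assume v: "v \<in> AB"
  obtain w w' where w: "w \<in> U" "E v w" "E w b" "E w c" "\<not> E w a"
    and w': "w' \<in> U" "E v w'" "E w' a" "E w' d" "\<not> E w' b"
    using AB_nbrs[OF v] by blast
  have "sum (shared v) {w, w'} \<le> weight v" using w w' by (intro W_ge) auto
  moreover have "w \<noteq> w'" using w w' by blast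
  moreover have "1 \<le> shared v w" "1 \<le> shared v w'" using v w w' by (auto simp: shared_def cls)
  ultimately show ?thesis by simp
qed

text \<open>A common neighbour of \<open>v\<close> and \<open>w\<close> in U may share neither ab
  with \<open>v\<close> nor bc with \<open>w\<close>; so it misses b and sees cd or da. This
  excludes b itself as an end of the common edge, and the two ends cannot share cd or da.\<close>

lemma AB_BC_cases:
  assumes v: "v \<in> AB" and w: "w \<in> BC" and n: "\<not> E v w"
  shows "\<exists>p\<in>CD. \<exists>q\<in>DA. E p q \<and> E v p \<and> E v q \<and> E w p \<and> E w q"
proof -
  have vU: "v \<in> U" and v': "E v a" "E v b" "\<not> E v c" "\<not> E v d" using v by (auto simp: cls)
  have wU: "w \<in> U" and w': "\<not> E w a" "E w b" "E w c" "\<not> E w d" using w by (auto simp: cls)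
  obtain p q where pq: "E p q" "E q p" "E v p" "E v q" "E w p" "E w q"
    using common_edge[OF U_V[OF vU] U_V[OF wU] _ n] v' w' by metis
  have r: "r = b \<or> r \<in> U \<and> \<not> E r b \<and> E r d \<and> (E r c \<or> E r a)" if "E v r" "E w r" for r
    using nbr_cases[OF that(1) vU]
  proof (elim disjE)
    assume "r \<in> U"
    then show ?thesis
      using types[OF \<open>r \<in> U\<close>] no_shared[OF that(1)] no_shared[OF that(2)] v' w' \<open>r \<in> U\<close>
      by argo
  qed (use that v' w' in auto)
  have "p \<in> CD \<and> q \<in> DA \<or> p \<in> DA \<and> q \<in> CD"
  proof -
    have "p \<noteq> b \<and> q \<noteq> b" using r[OF pq(3,5)] r[OF pq(4,6)] pq(1,2) irr by auto
    then have "p \<in> U \<and> q \<in> U \<and> \<not> E p b \<and> \<not> E q b \<and> E p d \<and> E q d \<and>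
      (E p c \<and> \<not> E p a \<and> E q a \<and> \<not> E q c \<or> E p a \<and> \<not> E p c \<and> E q c \<and> \<not> E q a)"
      using r[OF pq(3,5)] r[OF pq(4,6)] no_shared(3,4)[OF pq(1)] by blast
    then show ?thesis unfolding cls by auto
  qed
  then show ?thesis using pq by blast
qed

text \<open>The triangles \<open>v p q\<close> and \<open>w p q\<close> lie in U and have 12
  orderings.\<close>

lemma AB_BC_D:
  assumes v: "v \<in> AB" and w: "w \<in> BC" and n: "\<not> E v w"
  shows "12 \<le> triples U U U"
proof -
  obtain p q where pq: "p \<in> CD" "q \<in> DA" "E p q" "E v p" "E v q" "E w p" "E w q"
    using AB_BC_cases[OF assms] by blast
  have ne: "p \<noteq> q" "v \<noteq> w" "v \<noteq> p" "v \<noteq> q" "w \<noteq> p" "w \<noteq> q"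
    using pq irr v w by (auto simp: cls)
  have "triples {v, w} {p, q} {p, q} = 4"
    unfolding triples_def triangle_indicator_def using ne pq sym[OF pq(3)] irr by simp
  moreover have "triples ({p, q} \<union> {v, w}) ({p, q} \<union> {v, w}) ({p, q} \<union> {v, w}) \<le> triples U U U"
    using finU pq v w by (intro D_mono) (auto simp: cls)
  moreover have "triples ({p, q} \<union> {v, w}) ({p, q} \<union> {v, w}) ({p, q} \<union> {v, w})
      = triples {p, q} {p, q} {p, q} + 3 * triples {v, w} {p, q} {p, q} + 3 * triples {v, w} {v, w} {p, q}
        + triples {v, w} {v, w} {v, w}"
    using ne by (intro D_cube) auto
  ultimately show ?thesis by linarith
qed

text \<open>Having three neighbours in N(x), \<open>v\<close> has one in U by the degree condition.
  That vertex sees two of a, b, c, d, while \<open>v\<close> misses only one.\<close>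

lemma T_W: 
  assumes "v \<in> T" shows "1 \<le> weight v"
proof -
  have v: "v \<in> U" "nbhd_edges v = 2" using assms by (auto simp: T_def)
  have "{w \<in> U. E v w} \<noteq> {}"
  proof
    assume "{w \<in> U. E v w} = {}"
    then have 0: "card {w \<in> U. E v w} = 0" by (simp only: card.empty)
    have le: "of_bool P \<le> (1::nat)" for P by simp
    have "of_bool (E v a) = (1::nat)" "of_bool (E v b) = (1::nat)" "of_bool (E v c) = (1::nat)"
      "of_bool (E v d) = (1::nat)"
      using deg_U[OF v(1)] 0 le[of "E v a"] le[of "E v b"] le[of "E v c"] le[of "E v d"]
      by linarith+
    then have "E v a" "E v b" "E v c" "E v d" by (simp_all only: of_bool_eq_1_iff)
    then show False using v(2) unfolding ee_eq by simp
  qed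
  then obtain w where w: "w \<in> U" "E v w" by blast
  have "1 \<le> shared v w"
    using types[OF w(1)] v(2) unfolding shared_def ee_eq by (auto simp: of_bool_def split: if_splits)
  then show ?thesis using W_ge1[OF w] by linarith
qed

end

context K4_saturated_C4
begin

interpretation r: K4_saturated_C4 V E x b c d a by (rule rotate)
interpretation s: K4_saturated_C4 V E x c d a b by (rule r.rotate)
interpretation t: K4_saturated_C4 V E x d a b c by (rule s.rotate)

lemma rot_eqs:
  "r.AB = BC" "r.BC = CD" "r.CD = DA" "r.DA = AB"
  "s.AB = CD" "s.BC = DA" "s.CD = AB" "s.DA = BC"
  "t.AB = DA" "t.BC = AB" "t.CD = BC" "t.DA = CD"
  unfolding cls r.cls s.cls t.cls by auto

lemma rot_W: "r.weight = weight" "s.weight = weight" "t.weight = weight"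
  unfolding weight_def r.weight_def s.weight_def t.weight_def shared_def r.shared_def s.shared_def t.shared_def
  by (intro ext sum.cong refl; simp)+

lemma cls_W: "v \<in> AB \<union> BC \<union> CD \<union> DA \<Longrightarrow> 2 \<le> weight v"
  using AB_W r.AB_W s.AB_W t.AB_W unfolding rot_eqs rot_W by blast

lemma cls_D:
  assumes "triples U U U < 12"
  shows "v \<in> AB \<Longrightarrow> w \<in> BC \<Longrightarrow> E v w" "v \<in> BC \<Longrightarrow> w \<in> CD \<Longrightarrow> E v w"
    "v \<in> CD \<Longrightarrow> w \<in> DA \<Longrightarrow> E v w" "v \<in> DA \<Longrightarrow> w \<in> AB \<Longrightarrow> E v w"
  using AB_BC_D r.AB_BC_D s.AB_BC_D t.AB_BC_D assms unfolding rot_eqs by force+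

end

text \<open>What would remain if all weights were minimal: each vertex of U then has exactly one neighbour in
  each of the two adjacent classes, so every class has at most 2 elements, against \<open>card U \<ge> 10\<close>.\<close>

locale K4_saturated_C4_tight = K4_saturated_C4 +
  assumes tight: "\<And>v. v \<in> U \<Longrightarrow> nbhd_edges v = 1 \<and> weight v = 2"
begin

lemma rotate_tight: "K4_saturated_C4_tight V E x b c d a"
proof -
  interpret r: K4_saturated_C4 V E x b c d a by (rule rotate)
  have "r.weight = weight" "r.nbhd_edges = nbhd_edges"
    unfolding weight_def r.weight_def shared_def r.shared_def ee_eq r.ee_eq
    by (intro ext sum.cong refl; simp add: conj_commute)+
  then show ?thesis by unfold_locales (use tight in simp)
qed

lemma U_eq: "U = AB \<union> BC \<union> CD \<union> DA"
proof -
  have "T = {}" "F = {}" using tight by (fastforce simp: T_def F_def)+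
  then show ?thesis using U_cls by (metis Un_empty_right)
qed

lemma AB_nbrs':
  assumes v: "v \<in> AB" shows "\<exists>w\<in>BC. E v w" "\<exists>w\<in>DA. E v w"
  using AB_nbrs[OF v] U_eq unfolding cls by blast+

lemma AB_unique:
  assumes v: "v \<in> AB"
  shows "w \<in> BC \<Longrightarrow> w' \<in> BC \<Longrightarrow> E v w \<Longrightarrow> E v w' \<Longrightarrow> w = w'"
    and "w \<in> DA \<Longrightarrow> w' \<in> DA \<Longrightarrow> E v w \<Longrightarrow> E v w' \<Longrightarrow> w = w'"
proof -
  have *: False if "N \<subseteq> BC \<union> DA" "\<And>w. w \<in> N \<Longrightarrow> E v w" "card N = 3" for N
  proof -
    have "sum (shared v) N \<le> weight v" using that by (intro W_ge) (auto simp: cls)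
    moreover have "sum (shared v) N = (\<Sum>w\<in>N. 1)"
      using v that by (intro sum.cong) (auto simp: cls shared_def)
    ultimately show False using that tight[of v] v by (auto simp: cls)
  qed
  have ne: "BC \<inter> DA = {}" by (auto simp: cls)
  show "w = w'" if "w \<in> BC" "w' \<in> BC" "E v w" "E v w'"
  proof (rule ccontr)
    assume "w \<noteq> w'"
    obtain u where "u \<in> DA" "E v u" using AB_nbrs'[OF v] by blast
    moreover have "w \<noteq> u" "w' \<noteq> u" using ne that \<open>u \<in> DA\<close> by blast+
    ultimately show False using *[of "{w, w', u}"] that \<open>w \<noteq> w'\<close> by simp blast
  qed
  show "w = w'" if "w \<in> DA" "w' \<in> DA" "E v w" "E v w'"
  proof (rule ccontr)
    assume "w \<noteq> w'"
    obtain u where "u \<in> BC" "E v u" using AB_nbrs'[OF v] by blast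
    moreover have "w \<noteq> u" "w' \<noteq> u" using ne that \<open>u \<in> BC\<close> by blast+
    ultimately show False using *[of "{w, w', u}"] that \<open>w \<noteq> w'\<close> by simp blast
  qed
qed

end

context K4_saturated_C4_tight
begin

interpretation r: K4_saturated_C4_tight V E x b c d a by (rule rotate_tight)
interpretation s: K4_saturated_C4_tight V E x c d a b by (rule r.rotate_tight)
interpretation t: K4_saturated_C4_tight V E x d a b c by (rule s.rotate_tight)

lemma rot_eqs':
  "r.AB = BC" "r.BC = CD" "r.CD = DA" "r.DA = AB"
  "s.AB = CD" "s.BC = DA" "s.CD = AB" "s.DA = BC"
  "t.AB = DA" "t.BC = AB" "t.CD = BC" "t.DA = CD"
  unfolding cls r.cls s.cls t.cls by auto

text \<open>One vertex of \<open>BC\<close> is the neighbour of \<open>v\<close>. Any other is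
  reached along \<open>v\<close>, \<open>DA\<close>, \<open>CD\<close>, \<open>BC\<close>, where by
  uniqueness each step is determined by the previous one, so there is at most one.\<close>

lemma card_BC:
  assumes v: "v \<in> AB" shows "card BC \<le> 2" "BC \<noteq> {}"
proof -
  have fin: "finite BC" using finU by (simp add: cls)
  have "card {w \<in> BC. E v w} \<le> Suc 0"
    using AB_unique(1)[OF v] fin by (simp add: card_le_Suc0_iff_eq)
  moreover have "card {w \<in> BC. \<not> E v w} \<le> Suc 0"
  proof -
    have "w1 = w2" if w: "w1 \<in> BC" "\<not> E v w1" "w2 \<in> BC" "\<not> E v w2" for w1 w2
    proof -
      obtain p1 q1 where 1: "p1 \<in> CD" "q1 \<in> DA" "E p1 q1" "E v q1" "E w1 p1"
        using AB_BC_cases[OF v w(1,2)] by blast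
      obtain p2 q2 where 2: "p2 \<in> CD" "q2 \<in> DA" "E p2 q2" "E v q2" "E w2 p2"
        using AB_BC_cases[OF v w(3,4)] by blast
      have q: "q1 = q2" using AB_unique(2)[OF v] 1 2 by blast
      have p: "p1 = p2"
        using t.AB_unique(2)[unfolded rot_eqs', OF 1(2) 1(1) 2(1)] 1 2 q sym by blast
      show "w1 = w2"
        using s.AB_unique(2)[unfolded rot_eqs', OF 1(1) w(1) w(3)] 1 2 p sym by blast
    qed
    then show ?thesis using fin by (simp add: card_le_Suc0_iff_eq)
  qed
  moreover have "BC = {w \<in> BC. E v w} \<union> {w \<in> BC. \<not> E v w}" by auto
  then have "card BC \<le> card {w \<in> BC. E v w} + card {w \<in> BC. \<not> E v w}"
    by (metis card_Un_le)
  ultimately show "card BC \<le> 2" by linarith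
  show "BC \<noteq> {}" using AB_nbrs'[OF v] by blast
qed

end

context K4_saturated_C4_tight
begin

interpretation r: K4_saturated_C4_tight V E x b c d a by (rule rotate_tight)
interpretation s: K4_saturated_C4_tight V E x c d a b by (rule r.rotate_tight)
interpretation t: K4_saturated_C4_tight V E x d a b c by (rule s.rotate_tight)

lemma contradiction: False
proof -
  have rot_eqs':
    "r.AB = BC" "r.BC = CD" "s.AB = CD" "s.BC = DA" "t.AB = DA" "t.BC = AB"
    unfolding cls r.cls s.cls t.cls by auto
  note n = card_BC r.card_BC[unfolded rot_eqs'] s.card_BC[unfolded rot_eqs'] t.card_BC[unfolded rot_eqs']
  have "U \<noteq> {}" using card_U by auto
  then have "AB \<noteq> {}" "BC \<noteq> {}" "CD \<noteq> {}" "DA \<noteq> {}"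
    using n(2,4,6,8) unfolding U_eq by blast+
  then have "card AB \<le> 2" "card BC \<le> 2" "card CD \<le> 2" "card DA \<le> 2"
    using n(1,3,5,7) by blast+
  moreover have "card U \<le> card AB + card BC + card CD + card DA"
    unfolding U_eq by (meson add_le_mono card_Un_le le_refl le_trans)
  ultimately show False using card_U by linarith
qed

end

context K4_saturated_C4
begin

text \<open>Adjacent vertices of \<open>AB \<union> CD\<close> share nothing in N(x), so the weight
  there, at least 2 per vertex, comes entirely from edges leaving the set and is counted again at
  their other ends.\<close>

lemma sum_W_ge: "4 * card (AB \<union> CD) \<le> (\<Sum>v\<in>U. weight v)"
proof -
  let ?P = "AB \<union> CD"
  let ?g = "\<lambda>v w. if E v w then shared v w else 0"
  have PU: "?P \<subseteq> U" by (auto simp: cls)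
  then have fin: "finite ?P" "finite (U - ?P)" using finU by (auto intro: finite_subset)
  have weight: "weight v = (\<Sum>w\<in>U. ?g v w)" for v
    unfolding weight_def using finU by (simp add: sum.inter_filter)
  have split: "sum h U = sum h (U - ?P) + sum h ?P" for h :: "'a \<Rightarrow> nat"
    using sum.subset_diff[OF PU finU] .
  have "sum weight ?P = (\<Sum>v\<in>?P. \<Sum>w\<in>U - ?P. ?g v w)"
  proof (rule sum.cong[OF refl])
    fix v assume v: "v \<in> ?P"
    have "?g v w = 0" if "w \<in> ?P" for w
      using that v no_shared[of v w] by (auto simp: cls shared_def)
    then have "(\<Sum>w\<in>?P. ?g v w) = 0" by (rule sum.neutral[rule_format])
    then show "weight v = (\<Sum>w\<in>U - ?P. ?g v w)" unfolding weight split by simp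
  qed
  also have "\<dots> = (\<Sum>w\<in>U - ?P. \<Sum>v\<in>?P. ?g w v)"
    by (subst sum.swap) (intro sum.cong refl; simp add: E_sym shared_def conj_commute)
  also have "\<dots> \<le> sum weight (U - ?P)"
    using finU PU unfolding weight by (intro sum_mono sum_mono2) auto
  finally have 1: "sum weight ?P \<le> sum weight (U - ?P)" .
  have "(\<Sum>v\<in>?P. 2) \<le> sum weight ?P" by (intro sum_mono) (auto intro: cls_W)
  then show ?thesis using 1 split[of weight] by simp
qed

end

context K4_saturated_C4
begin

interpretation r: K4_saturated_C4 V E x b c d a by (rule rotate)

lemma sum_W_ge': "4 * card (BC \<union> DA) \<le> (\<Sum>v\<in>U. weight v)"
proof -
  have "r.AB = BC" "r.CD = DA" "r.weight = weight"
    unfolding cls r.cls weight_def r.weight_def shared_def r.shared_def by (auto intro!: ext sum.cong)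
  then show ?thesis using r.sum_W_ge by simp
qed

lemma weight_ge:
  assumes "v \<in> U" shows "of_bool (v \<in> T) + 4 * of_bool (v \<in> F) \<le> 2 * int (nbhd_edges v) + int (weight v) - 4"
proof -
  consider "v \<in> AB \<union> BC \<union> CD \<union> DA" | "v \<in> T" | "v \<in> F"
    using U_cls assms by blast
  then show ?thesis
  proof cases
    case 1
    then have "nbhd_edges v = 1" using ee_cls by blast
    then show ?thesis using cls_W[OF 1] by (simp add: T_def F_def)
  next
    case 2
    then show ?thesis using T_W by (fastforce simp: T_def F_def)
  next
    case 3
    then show ?thesis by (simp add: T_def F_def)
  qed
qed

text \<open>All summands are nonnegative; if the sum vanished, each would, which is the tight
  situation already refuted.\<close>

lemma sum_weight_pos: "0 < (\<Sum>v\<in>U. 2 * int (nbhd_edges v) + int (weight v) - 4)"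
proof (rule ccontr)
  let ?h = "\<lambda>v. 2 * int (nbhd_edges v) + int (weight v) - 4"
  assume "\<not> 0 < sum ?h U"
  have nonneg: "0 \<le> ?h v" if "v \<in> U" for v
    using weight_ge[OF that] by (simp add: of_bool_def split: if_splits)
  then have "0 \<le> sum ?h U" by (rule sum_nonneg)
  with \<open>\<not> 0 < sum ?h U\<close> have "sum ?h U = 0" by linarith
  then have h: "?h v = 0" if "v \<in> U" for v
    using sum_nonneg_eq_0_iff[of U ?h] finU nonneg that by blast
  have "K4_saturated_C4_tight V E x a b c d"
  proof
    fix v assume v: "v \<in> U"
    have "v \<notin> T" "v \<notin> F" using weight_ge[OF v] h[OF v] by (auto simp: of_bool_def split: if_splits)
    then have "nbhd_edges v = 1" using U_cls v ee_cls by blast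
    then show "nbhd_edges v = 1 \<and> weight v = 2" using h[OF v] by simp
  qed
  then show False by (rule K4_saturated_C4_tight.contradiction)
qed

text \<open>The cycle contributes 8 to \<open>excess\<close>. Either U holds 12 ordered triangles
  and any positive surplus suffices, or cyclically consecutive classes are completely joined and the
  surplus must exceed 4.\<close>

lemma excess_C4: "36 < 3 * excess + int (triples U U U)"
proof -
  let ?h = "\<lambda>v. 2 * int (nbhd_edges v) + int (weight v) - 4"
  have ex: "excess = 8 + sum ?h U" unfolding excess_def mm_eq by simp
  show ?thesis
  proof (cases "triples U U U < 12")
    case False
    then show ?thesis using sum_weight_pos ex by simp
  next
    case True
    define P where "P = AB \<union> CD"
    define Q where "Q = BC \<union> DA"
    have PQ: "E v w" "E w v" if "v \<in> P" "w \<in> Q" for v w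
      using that cls_D[OF True] sym unfolding P_def Q_def by blast+
    have U: "U = P \<union> Q \<union> T \<union> F" using U_cls unfolding P_def Q_def by blast
    have disj: "P \<inter> Q = {}" "P \<inter> T = {}" "Q \<inter> T = {}" "P \<inter> F = {}" "Q \<inter> F = {}" "T \<inter> F = {}"
      unfolding P_def Q_def T_def F_def using ee_cls by (auto simp: cls)
    have com1: "shared v w = 1" "shared w v = 1" if "v \<in> P" "w \<in> Q" for v w
      using that unfolding P_def Q_def shared_def by (auto simp: cls)
    have sub: "P \<subseteq> U" "Q \<subseteq> U" using U by auto
    have ee1: "nbhd_edges v = 1" if "v \<in> P \<union> Q" for v using that ee_cls unfolding P_def Q_def by blast
    have WP: "card Q \<le> weight v" if "v \<in> P" for v
    proof -
      have "sum (shared v) Q \<le> weight v" using that PQ sub by (intro W_ge) auto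
      then show ?thesis using com1 that by simp
    qed
    have WQ: "card P \<le> weight v" if "v \<in> Q" for v
    proof -
      have "sum (shared v) P \<le> weight v" using that PQ sub by (intro W_ge) auto
      then show ?thesis using com1 that by simp
    qed
    have c: "card {v \<in> U. v \<in> P} = card P" "card {v \<in> U. v \<in> Q} = card Q"
      "card {v \<in> U. v \<in> T} = card T" "card {v \<in> U. v \<in> F} = card F"
      using U by (auto intro: arg_cong[of _ _ card])
    have "(\<Sum>v\<in>U. 1 * of_bool (v \<in> P) + 1 * of_bool (v \<in> Q) + 1 * of_bool (v \<in> T) + 1 * of_bool (v \<in> F))
      = (\<Sum>v\<in>U. 1 :: int)"
      using U disj by (intro sum.cong) auto
    then have cU: "int (card P) + int (card Q) + int (card T) + int (card F) = int (card U)"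
      unfolding sum.distrib sum_of_bool_int c by simp
    have 1: "int (card T) + 4 * int (card F) \<le> sum ?h U"
    proof -
      have "(\<Sum>v\<in>U. 1 * of_bool (v \<in> T) + 4 * of_bool (v \<in> F)) \<le> sum ?h U"
        using weight_ge by (intro sum_mono) simp
      then show ?thesis unfolding sum.distrib sum_of_bool_int c by simp
    qed
    have 2: "- 2 * int (card P) - 2 * int (card Q) + int (\<Sum>v\<in>U. weight v) \<le> sum ?h U"
    proof -
      have "(\<Sum>v\<in>U. - 2 * of_bool (v \<in> P) + - 2 * of_bool (v \<in> Q) + int (weight v)) \<le> sum ?h U"
      proof (rule sum_mono)
        fix v assume "v \<in> U"
        then consider "v \<in> P" | "v \<in> Q" | "v \<in> T" | "v \<in> F" using U by blast
        then show "- 2 * of_bool (v \<in> P) + - 2 * of_bool (v \<in> Q) + int (weight v) \<le> ?h v"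
          using disj ee1[of v] by cases (auto simp: T_def F_def)
      qed
      then show ?thesis unfolding sum.distrib sum_of_bool_int c by simp
    qed
    have 3: "(int (card Q) - 2) * int (card P) + (int (card P) - 2) * int (card Q) + int (card T)
      + 4 * int (card F) \<le> sum ?h U"
    proof -
      have "(\<Sum>v\<in>U. (int (card Q) - 2) * of_bool (v \<in> P) + (int (card P) - 2) * of_bool (v \<in> Q)
        + 1 * of_bool (v \<in> T) + 4 * of_bool (v \<in> F)) \<le> sum ?h U"
      proof (rule sum_mono)
        fix v assume v: "v \<in> U"
        then consider "v \<in> P" | "v \<in> Q" | "v \<in> T \<union> F" using U by blast
        then show "(int (card Q) - 2) * of_bool (v \<in> P) + (int (card P) - 2) * of_bool (v \<in> Q)
          + 1 * of_bool (v \<in> T) + 4 * of_bool (v \<in> F) \<le> ?h v"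
        proof cases
          case 1
          then have "v \<notin> Q" "v \<notin> T" "v \<notin> F" using disj by blast+
          then show ?thesis using 1 WP[OF 1] ee1[of v] by simp
        next
          case 2
          then have "v \<notin> P" "v \<notin> T" "v \<notin> F" using disj by blast+
          then show ?thesis using 2 WQ[OF 2] ee1[of v] by simp
        next
          case 3
          then have "v \<notin> P" "v \<notin> Q" using disj by blast+
          then show ?thesis using weight_ge[OF v] by simp
        qed
      qed
      then show ?thesis unfolding sum.distrib sum_of_bool_int c by simp
    qed
    have 4: "4 * int (card P) \<le> int (\<Sum>v\<in>U. weight v)" "4 * int (card Q) \<le> int (\<Sum>v\<in>U. weight v)"
      using sum_W_ge sum_W_ge' unfolding P_def Q_def by linarith+
    \<comment> \<open>If both sides have at least 2 vertices, the complete join gives enough. If one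
      side has at most 1, then either the other is large and the doubled weight bound
      \<open>4\<close> applies, or \<open>T\<close> and \<open>F\<close> together contain at least 6
      vertices.\<close>
    have "4 < sum ?h U"
    proof (cases "2 \<le> card P \<and> 2 \<le> card Q")
      case True
      obtain p where p: "card P = 2 + p" using True le_Suc_ex[of 2 "card P"] by blast
      obtain q where q: "card Q = 2 + q" using True le_Suc_ex[of 2 "card Q"] by blast
      from p q have pq: "int (card P) = 2 + int p" "int (card Q) = 2 + int q" by simp_all
      define X where "X = int p * int q"
      have "2 * int p + 2 * int q + 2 * X + int (card T) + 4 * int (card F) \<le> sum ?h U"
        using 3 unfolding pq X_def by (simp add: algebra_simps)
      moreover have "0 \<le> X" unfolding X_def by simp
      ultimately show ?thesis using cU card_U pq by linarith
    next
      case False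
      then show ?thesis using 1 2 4 cU card_U by linarith
    qed
    then show ?thesis using ex by simp
  qed
qed

end

context K4_saturated_graph
begin

section \<open>A star and a matching in the neighbourhood\<close>

text \<open>Every vertex of U sees the centre d. Hence \<open>nbhd_edges\<close> counts the leaves
  it sees, and \<open>weight\<close> is its degree inside U, since neighbours in U share only
  d.\<close>

lemma excess_star:
  assumes e: "E a d" "E b d" "E c d" "\<not> E a b" "\<not> E a c" "\<not> E b c"
  shows "12 < excess"
proof -
  have e': "E d a" "E d b" "E d c" "\<not> E b a" "\<not> E c a" "\<not> E c b" using e sym by blast+
  \<comment> \<open>Restricting to U makes \<open>tri\<close> true for arbitrary vertices: a
    triangle inside U together with d would be a \<open>K4\<close>.\<close>
  define E' where "E' u v \<longleftrightarrow> u \<in> U \<and> v \<in> U \<and> E u v" for u v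
  have t: "E u d \<and> (E u a \<or> E u b \<or> E u c)" if "u \<in> U" for u
    using U_edge[OF that] e by metis
  have dis: "\<not> (E u a \<and> E v a) \<and> \<not> (E u b \<and> E v b) \<and> \<not> (E u c \<and> E v c)"
    if "u \<in> U" "v \<in> U" "E u v" for u v
    using K4[OF that(3)] t[OF that(1)] t[OF that(2)] e by blast
  have far: "\<exists>w\<in>U. E' v w \<and> E w i" if v: "v \<in> U" "\<not> E v i" and i: "i \<in> {a, b, c}" for v i
  proof -
    have "i \<in> V" "v \<noteq> i" "i \<noteq> x" using i in_V U_neq[OF v(1)] x_neq by auto
    then obtain p q where pq: "E p q" "E q p" "E v p" "E v q" "E i p" "E i q"
      using common_edge[OF U_V[OF v(1)] _ _ v(2)] by metis
    have r: "r = d \<or> r \<in> U" if "E v r" "E i r" for r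
      using nbr_cases[OF that(1) v(1)] that i e e' irr by auto
    have "p \<in> U \<or> q \<in> U" using r[OF pq(3,5)] r[OF pq(4,6)] pq(1) irr by blast
    then show ?thesis using pq v(1) sym unfolding E'_def by blast
  qed
  have d_eq: "{w \<in> U. E' v w} = {w \<in> U. E v w}" if "v \<in> U" for v
    using that unfolding E'_def by blast
  interpret m: maximal_triangle_free U E' "\<lambda>v. E v a" "\<lambda>v. E v b" "\<lambda>v. E v c"
  proof
    show "finite U" "10 \<le> card U" using finU card_U by blast+
    show "E' v u" if "E' u v" for u v using that sym unfolding E'_def by blast
    show False if "E' u v" "E' v w" "E' u w" for u v w
      using K4[of u v w d] that t unfolding E'_def by blast
    show "E v a \<or> E v b \<or> E v c" if "v \<in> U" for v using t[OF that] by blast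
    show "\<not> (E u a \<and> E v a) \<and> \<not> (E u b \<and> E v b) \<and> \<not> (E u c \<and> E v c)"
      if "u \<in> U" "v \<in> U" "E' u v" for u v
      using dis that unfolding E'_def by blast
    show "\<exists>w\<in>U. E' v w \<and> E w a" if "v \<in> U" "\<not> E v a" for v using far[OF that] by blast
    show "\<exists>w\<in>U. E' v w \<and> E w b" if "v \<in> U" "\<not> E v b" for v using far[OF that] by blast
    show "\<exists>w\<in>U. E' v w \<and> E w c" if "v \<in> U" "\<not> E v c" for v using far[OF that] by blast
    show "3 \<le> card {w \<in> U. E' v w} + of_bool (E v a) + of_bool (E v b) + of_bool (E v c)"
      if "v \<in> U" for v
      using deg_U[OF that] t[OF that] d_eq[OF that] by simp
    show "\<exists>w\<in>U. E' u w \<and> E' v w" if uv: "u \<in> U" "v \<in> U" "u \<noteq> v" "\<not> E' u v"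
      "\<not> (E u a \<and> E v a)" "\<not> (E u b \<and> E v b)" "\<not> (E u c \<and> E v c)" for u v
    proof -
      have "\<not> E u v" using uv unfolding E'_def by blast
      then obtain p q where pq: "E p q" "E q p" "E u p" "E u q" "E v p" "E v q"
        using common_edge[OF U_V[OF uv(1)] U_V[OF uv(2)] uv(3)] by metis
      have r: "r = d \<or> r \<in> U" if "E u r" "E v r" for r
        using nbr_cases[OF that(1) uv(1)] that uv(5-7) by auto
      have "p \<in> U \<or> q \<in> U" using r[OF pq(3,5)] r[OF pq(4,6)] pq(1) irr by blast
      then show ?thesis using pq uv(1,2) unfolding E'_def by blast
    qed
  qed
  have "2 * int (nbhd_edges v) + int (weight v) - 4
    = 2 * (of_bool (E v a) + of_bool (E v b) + of_bool (E v c)) + int (card {w \<in> U. E' v w}) - 4"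
    if v: "v \<in> U" for v
  proof -
    have "weight v = (\<Sum>w | w \<in> U \<and> E v w. 1)"
      unfolding weight_def using t[OF v] t dis[OF v] by (intro sum.cong refl) (auto simp: shared_def)
    then have "weight v = card {w \<in> U. E' v w}" using d_eq[OF v] by simp
    moreover have "nbhd_edges v = of_bool (E v a) + of_bool (E v b) + of_bool (E v c)"
      unfolding nbhd_edges_def using e t[OF v] by simp
    ultimately show ?thesis by simp
  qed
  then have "(\<Sum>v\<in>U. 2 * int (nbhd_edges v) + int (weight v) - 4)
      = (\<Sum>v\<in>U. 2 * (of_bool (E v a) + of_bool (E v b) + of_bool (E v c))
      + int (card {w \<in> U. E' v w}) - 4)"
    by (rule sum.cong[OF refl])
  moreover have "root_edges = 3" unfolding root_edges_def using e by simp
  ultimately show ?thesis unfolding excess_def using m.weight_gt by linarith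
qed

text \<open>Outside \<open>I\<close>, vertices see one matching edge and exactly one end of the
  other. The two resulting types are completely joined, and an edge between them has at least two
  common neighbours in N(x). The minimum 12 occurs when each type has two members.\<close>

lemma excess_2K2:
  assumes e: "E a b" "E c d" "\<not> E a c" "\<not> E a d" "\<not> E b c" "\<not> E b d"
  defines "I \<equiv> {v \<in> U. E v a \<and> E v b \<and> E v c \<and> E v d}"
  shows "12 \<le> excess"
    and "excess = 12 \<Longrightarrow> \<exists>p q r s. U = {p, q, r, s} \<union> I
      \<and> (E p a \<and> E p b \<and> E p c \<and> \<not> E p d) \<and> (E q a \<and> E q b \<and> \<not> E q c \<and> E q d)
      \<and> (E r a \<and> \<not> E r b \<and> E r c \<and> E r d) \<and> (\<not> E s a \<and> E s b \<and> E s c \<and> E s d)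
      \<and> (E p r \<and> E p s \<and> E q r \<and> E q s \<and> \<not> E p q \<and> \<not> E r s)"
proof -
  have e': "E b a" "E d c" "\<not> E c a" "\<not> E d a" "\<not> E c b" "\<not> E d b" using e sym by blast+
  have t: "E u a \<and> E u b \<or> E u c \<and> E u d" if "u \<in> U" for u
    using U_edge[OF that] e by metis
  have k: "\<not> (E u a \<and> E u b \<and> E v a \<and> E v b)" "\<not> (E u c \<and> E u d \<and> E v c \<and> E v d)"
    if "E u v" for u v
    using K4[OF that] e by blast+
  have tAB: "E u c \<or> E u d" if u: "u \<in> U" "E u a" for u
  proof (rule ccontr)
    assume n: "\<not> (E u c \<or> E u d)"
    then obtain p q where pq: "E p q" "E q p" "E u p" "E u q" "E c p" "E c q"
      using common_edge[of u c] U_V[OF u(1)] in_V U_neq[OF u(1)] by metis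
    have pU: "p \<in> U" "q \<in> U"
      using nbr_cases[OF pq(3) u(1)] nbr_cases[OF pq(4) u(1)] pq n e e' by auto
    show False
      using t[OF pU(1)] t[OF pU(2)] t[OF u(1)] k[OF pq(1)] k[OF pq(3)] k[OF pq(4)] n by argo
  qed
  have tCD: "E u a \<or> E u b" if u: "u \<in> U" "E u c" for u
  proof (rule ccontr)
    assume n: "\<not> (E u a \<or> E u b)"
    then obtain p q where pq: "E p q" "E q p" "E u p" "E u q" "E a p" "E a q"
      using common_edge[of u a] U_V[OF u(1)] in_V U_neq[OF u(1)] by metis
    have pU: "p \<in> U" "q \<in> U"
      using nbr_cases[OF pq(3) u(1)] nbr_cases[OF pq(4) u(1)] pq n e e' by auto
    show False
      using t[OF pU(1)] t[OF pU(2)] t[OF u(1)] k[OF pq(1)] k[OF pq(3)] k[OF pq(4)] n by argo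
  qed
  define pA where "pA v \<longleftrightarrow> E v a \<and> E v b \<and> (E v c \<longleftrightarrow> \<not> E v d)" for v
  define pB where "pB v \<longleftrightarrow> E v c \<and> E v d \<and> (E v a \<longleftrightarrow> \<not> E v b)" for v
  note p = pA_def pB_def
  have cases: "v \<in> I \<or> pA v \<or> pB v" if "v \<in> U" for v
    using t[OF that] tAB[OF that] tCD[OF that] that unfolding I_def p by blast
  have AB: "E v w" "E w v" if vw: "v \<in> U" "w \<in> U" "pA v" "pB w" for v w
  proof -
    show "E v w"
    proof (rule ccontr)
      assume n: "\<not> E v w"
      have "v \<noteq> w" using vw p by blast
      then obtain p q where pq: "E p q" "E q p" "E v p" "E v q" "E w p" "E w q"
        using common_edge[OF U_V[OF vw(1)] U_V[OF vw(2)] _ n] by metis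
      have r: "r \<in> {a, b} \<and> E w r \<or> r \<in> {c, d} \<and> E v r" if "E v r" "E w r" for r
        using nbr_cases[OF that(1) vw(1)] t[of r] k[OF that(1)] k[OF that(2)] that vw(3,4)
        by - (elim disjE; auto simp: p)
      show False
        using r[OF pq(3,5)] r[OF pq(4,6)] pq vw(3,4) e e' irr unfolding p by auto
    qed
    then show "E w v" by (rule sym)
  qed
  \<comment> \<open>The adjacent common neighbours of \<open>i\<close> and \<open>j\<close> cannot
    share a matching edge, so neither sees all of N(x) and they are of opposite types.\<close>
  have mixed: "\<exists>p q. p \<in> U \<and> q \<in> U \<and> pA p \<and> pB q \<and> E p i \<and> E p j \<and> E q i \<and> E q j"
    if ij: "i \<in> {a, b}" "j \<in> {c, d}" for i j
  proof -
    have ijV: "i \<in> V" "j \<in> V" "i \<noteq> j" "\<not> E i j" using ij in_V dist' e by auto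
    obtain p q where pq: "E p q" "E q p" "E i p" "E i q" "E j p" "E j q"
      using common_edge[OF ijV] .
    have r: "r = x \<or> r \<in> U" if "E i r" "E j r" for r
      using nbr_of[OF ijV(1) that(1)] that ij e e' irr by auto
    have pU: "p \<in> U" "q \<in> U" using r[OF pq(3,5)] r[OF pq(4,6)] pq(1,2) U_x irr by blast+
    have "pA p \<and> pB q \<or> pA q \<and> pB p"
      using t[OF pU(1)] t[OF pU(2)] tAB[OF pU(1)] tAB[OF pU(2)] tCD[OF pU(1)] tCD[OF pU(2)]
        k[OF pq(1)] unfolding p by blast
    then show ?thesis using pU pq(3-6) sym by blast
  qed
  \<comment> \<open>The pairs (a, c) and (b, d) give distinct vertices in each type:
    \<open>p1\<close> sees c but \<open>p2\<close> sees d, and \<open>q1\<close> sees a but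
    \<open>q2\<close> sees b.\<close>
  obtain p1 q1 where m1: "p1 \<in> U" "q1 \<in> U" "pA p1" "pB q1" "E p1 c" "E q1 a"
    using mixed[of a c] by auto
  obtain p2 q2 where m2: "p2 \<in> U" "q2 \<in> U" "pA p2" "pB q2" "E p2 d" "E q2 b"
    using mixed[of b d] by auto
  have ne: "p1 \<noteq> p2" "q1 \<noteq> q2" using m1 m2 unfolding p by blast+
  define A where "A = {v \<in> U. pA v}"
  define C where "C = {v \<in> U. pB v}"
  have fin: "finite A" "finite C" unfolding A_def C_def using finU by auto
  have sub: "{p1, p2} \<subseteq> A" "{q1, q2} \<subseteq> C" using m1 m2 unfolding A_def C_def by auto
  have "2 \<le> card A" "2 \<le> card C" using card_mono[OF fin(1) sub(1)] card_mono[OF fin(2) sub(2)] ne by simp_all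
  then obtain nA nC where n: "card A = 2 + nA" "card C = 2 + nC"
    using le_Suc_ex[of 2 "card A"] le_Suc_ex[of 2 "card C"] by blast
  have com2: "2 \<le> shared v w" "2 \<le> shared w v" if "pA v" "pB w" for v w
    using that unfolding p shared_def by auto
  have WA: "2 * card C \<le> weight v" if "v \<in> A" for v
  proof -
    have "sum (shared v) C \<le> weight v" using that AB unfolding A_def C_def by (intro W_ge) auto
    moreover have "(\<Sum>w\<in>C. 2) \<le> sum (shared v) C"
      using that com2 unfolding A_def C_def by (intro sum_mono) auto
    ultimately show ?thesis by simp
  qed
  have WC: "2 * card A \<le> weight v" if "v \<in> C" for v
  proof -
    have "sum (shared v) A \<le> weight v" using that AB unfolding A_def C_def by (intro W_ge) auto
    moreover have "(\<Sum>w\<in>A. 2) \<le> sum (shared v) A"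
      using that com2 unfolding A_def C_def by (intro sum_mono) auto
    ultimately show ?thesis by simp
  qed
  have "(\<Sum>v\<in>U. (2 * int (card C) - 2) * of_bool (v \<in> A) + (2 * int (card A) - 2) * of_bool (v \<in> C))
    \<le> (\<Sum>v\<in>U. 2 * int (nbhd_edges v) + int (weight v) - 4)"
  proof (rule sum_mono)
    fix v assume v: "v \<in> U"
    have disj: "\<not> (v \<in> A \<and> v \<in> C)" unfolding A_def C_def p by blast
    consider "v \<in> A" | "v \<in> C" | "v \<in> I" "v \<notin> A" "v \<notin> C" using cases[OF v] v unfolding A_def C_def by blast
    then show "(2 * int (card C) - 2) * of_bool (v \<in> A) + (2 * int (card A) - 2) * of_bool (v \<in> C)
      \<le> 2 * int (nbhd_edges v) + int (weight v) - 4"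
    proof cases
      case 1
      then have "nbhd_edges v = 1" unfolding A_def p nbhd_edges_def using e by auto
      then show ?thesis using 1 disj WA[OF 1] by simp
    next
      case 2
      then have "nbhd_edges v = 1" unfolding C_def p nbhd_edges_def using e by auto
      then show ?thesis using 2 disj WC[OF 2] by simp
    next
      case 3
      then have "nbhd_edges v = 2" unfolding I_def nbhd_edges_def using e by auto
      then show ?thesis using 3 by simp
    qed
  qed
  moreover have "{v \<in> U. v \<in> A} = A" "{v \<in> U. v \<in> C} = C" unfolding A_def C_def by auto
  moreover have "root_edges = 2" unfolding root_edges_def using e by simp
  ultimately have "4 + (2 * int (card C) - 2) * int (card A) + (2 * int (card A) - 2) * int (card C) \<le> excess"
    unfolding excess_def sum.distrib sum_of_bool_int by simp
  moreover define Y where "Y = int nA * int nC"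
  ultimately have ex: "12 + 6 * int nA + 6 * int nC + 4 * Y \<le> excess"
    unfolding n Y_def by (simp add: algebra_simps)
  have Y: "0 \<le> Y" unfolding Y_def by simp
  show "12 \<le> excess" using ex Y by linarith
  assume "excess = 12"
  then have "nA = 0" "nC = 0" using ex Y by linarith+
  then have "A = {p1, p2}" "C = {q1, q2}"
    using card_seteq[OF fin(1) sub(1)] card_seteq[OF fin(2) sub(2)] n ne by simp_all
  then have UI': "U = {p1, p2, q1, q2} \<union> I"
    using cases m1 m2 unfolding A_def C_def I_def by blast
  have "E p1 q1 \<and> E p1 q2 \<and> E p2 q1 \<and> E p2 q2" using m1 m2 AB by blast
  moreover have "\<not> E p1 p2" "\<not> E q1 q2"
    using k[of p1 p2] k[of q1 q2] m1 m2 unfolding p by blast+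
  moreover have "E p1 a \<and> E p1 b \<and> E p1 c \<and> \<not> E p1 d" "E p2 a \<and> E p2 b \<and> \<not> E p2 c \<and> E p2 d"
    "E q1 a \<and> \<not> E q1 b \<and> E q1 c \<and> E q1 d" "\<not> E q2 a \<and> E q2 b \<and> E q2 c \<and> E q2 d"
    using m1 m2 unfolding p by blast+
  ultimately show "\<exists>p q r s. U = {p, q, r, s} \<union> I
      \<and> (E p a \<and> E p b \<and> E p c \<and> \<not> E p d) \<and> (E q a \<and> E q b \<and> \<not> E q c \<and> E q d)
      \<and> (E r a \<and> \<not> E r b \<and> E r c \<and> E r d) \<and> (\<not> E s a \<and> E s b \<and> E s c \<and> E s d)
      \<and> (E p r \<and> E p s \<and> E q r \<and> E q s \<and> \<not> E p q \<and> \<not> E r s)"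
    using UI' by (intro exI[of _ p1] exI[of _ p2] exI[of _ q1] exI[of _ q2]) simp
qed

end

section \<open>The extremal graph\<close>

text \<open>Graph isomorphisms here also act on arcs. As arcs are pairs, the arc map is the vertex
  map on both components; it is built from the inverse of \<open>g\<close>, which runs from H to
  G.\<close>

lemma digraph_isoI:
  fixes G :: "'a pair_pre_digraph" and H :: "'b pair_pre_digraph"
  assumes G: "pair_graph G" and H: "pair_graph H"
    and g: "bij_betw g (pverts H) (pverts G)"
    and arcs: "\<And>s t. s \<in> pverts H \<Longrightarrow> t \<in> pverts H \<Longrightarrow> (s, t) \<in> parcs H \<longleftrightarrow> (g s, g t) \<in> parcs G"
  shows "digraph_iso (with_proj G) (with_proj H)"
proof -
  interpret G: pair_graph G by fact
  interpret H: pair_graph H by fact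
  let ?f = "inv_into (pverts H) g"
  let ?hom = "\<lparr>iso_verts = ?f, iso_arcs = map_prod ?f ?f, iso_head = snd, iso_tail = fst\<rparr>"
  have f: "bij_betw ?f (pverts G) (pverts H)" using g by (rule bij_betw_inv_into)
  have gf: "g (?f u) = u" if "u \<in> pverts G" for u
    using g that by (rule bij_betw_inv_into_right)
  have fg: "?f (g u) = u" if "u \<in> pverts H" for u
    using g that by (rule bij_betw_inv_into_left)
  have fV: "?f u \<in> pverts H" if "u \<in> pverts G" for u
    using f that by (auto simp: bij_betw_def)
  have gV: "g u \<in> pverts G" if "u \<in> pverts H" for u
    using g that by (auto simp: bij_betw_def)
  have GV: "u \<in> pverts G" "v \<in> pverts G" if "(u, v) \<in> parcs G" for u v
    using G.in_arcsD1 G.in_arcsD2 that by blast+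
  have HV: "u \<in> pverts H" "v \<in> pverts H" if "(u, v) \<in> parcs H" for u v
    using H.in_arcsD1 H.in_arcsD2 that by blast+
  have "inj_on (map_prod ?f ?f) (parcs G)"
  proof (rule inj_onI)
    fix e e' assume *: "e \<in> parcs G" "e' \<in> parcs G" "map_prod ?f ?f e = map_prod ?f ?f e'"
    obtain u v u' v' where "e = (u, v)" "e' = (u', v')" by (cases e; cases e') blast
    then show "e = e'" using * GV gf by (metis map_prod_simp prod.inject)
  qed
  moreover have "wf_digraph (with_proj G)" by unfold_locales
  ultimately have "pre_digraph.digraph_isomorphism (with_proj G) ?hom"
    using f by (simp add: pre_digraph.digraph_isomorphism_def bij_betw_def)
  moreover have "map_prod ?f ?f ` parcs G = parcs H"
  proof
    show "map_prod ?f ?f ` parcs G \<subseteq> parcs H"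
      using arcs fV gf GV by (auto simp: image_iff)
    show "parcs H \<subseteq> map_prod ?f ?f ` parcs G"
    proof
      fix e assume e: "e \<in> parcs H"
      obtain s t where st: "e = (s, t)" by (cases e)
      have "e = map_prod ?f ?f (g s, g t)" using fg HV e st by auto
      moreover have "(g s, g t) \<in> parcs G" using arcs HV e st by blast
      ultimately show "e \<in> map_prod ?f ?f ` parcs G" by blast
    qed
  qed
  then have "with_proj H = app_iso ?hom (with_proj G)"
    using f by (simp add: app_iso_def with_proj_def bij_betw_def)
  ultimately show ?thesis unfolding digraph_iso_def by blast
qed

text \<open>The condition mentions neither x nor a, b, c, d, so it may be proved under any
  relabelling of the neighbours.\<close>

definition extremal_bound :: "'a set \<Rightarrow> ('a \<Rightarrow> 'a \<Rightarrow> bool) \<Rightarrow> bool" where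
  "extremal_bound V E \<longleftrightarrow>
    2 * card V \<le> card (K4_saturated_graph.triangles V E) + 4 \<and>
    (card (K4_saturated_graph.triangles V E) + 4 = 2 * card V \<longrightarrow>
      (\<exists>g. bij_betw g (h4_verts (card V)) V \<and>
        (\<forall>s\<in>h4_verts (card V). \<forall>t\<in>h4_verts (card V). (s, t) \<in> parcs (H4 (card V)) \<longleftrightarrow> E (g s) (g t))))"

context K4_saturated_graph
begin

lemma extremal_bound_strict:
  assumes "36 < 3 * excess + int (triples U U U)"
  shows "extremal_bound V E"
proof -
  have "2 * card V < card triangles + 4" using triangles_ge assms by linarith
  then show ?thesis unfolding extremal_bound_def by simp
qed

lemma extremal_bound_star:
  assumes "E a d" "E b d" "E c d" "\<not> E a b" "\<not> E a c" "\<not> E b c"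
  shows "extremal_bound V E"
  using excess_star[OF assms] by (intro extremal_bound_strict) simp

lemma extremal_bound_P4:
  assumes "E a b" "E b c" "E c d" "\<not> E a c" "\<not> E a d" "\<not> E b d"
  shows "extremal_bound V E"
  using excess_P4[OF assms] by (intro extremal_bound_strict) simp

lemma extremal_bound_C4:
  assumes "E a b" "E b c" "E c d" "E a d" "\<not> E a c" "\<not> E b d"
  shows "extremal_bound V E"
proof -
  interpret K4_saturated_C4 V E x a b c d
    by unfold_locales (use assms sym in blast)+
  show ?thesis using excess_C4 by (rule extremal_bound_strict)
qed

lemma H4_map:
  assumes e: "E a b" "E c d" "\<not> E a c" "\<not> E a d" "\<not> E b c" "\<not> E b d"
    and I: "I = {v \<in> U. E v a \<and> E v b \<and> E v c \<and> E v d}" and U: "U = {p, q, r, s} \<union> I"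
    and p: "E p a" "E p b" "E p c" "\<not> E p d" and q: "E q a" "E q b" "\<not> E q c" "E q d"
    and r: "E r a" "\<not> E r b" "E r c" "E r d" and s: "\<not> E s a" "E s b" "E s c" "E s d"
    and pqrs: "E p r" "E p s" "E q r" "E q s" "\<not> E p q" "\<not> E r s"
  shows "\<exists>g. bij_betw g (h4_verts (card V)) V \<and>
        (\<forall>s\<in>h4_verts (card V). \<forall>t\<in>h4_verts (card V). (s, t) \<in> parcs (H4 (card V)) \<longleftrightarrow> E (g s) (g t))"
proof -
  have e': "E b a" "E d c" "\<not> E c a" "\<not> E d a" "\<not> E c b" "\<not> E d b" using e sym by blast+
  have sy: "E a p" "E b p" "E c p" "\<not> E d p" "E a q" "E b q" "\<not> E c q" "E d q"
    "E a r" "\<not> E b r" "E c r" "E d r" "\<not> E a s" "E b s" "E c s" "E d s"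
    "E r p" "E s p" "E r q" "E s q" "\<not> E q p" "\<not> E s r"
    using p q r s pqrs sym by blast+
  have inU: "p \<in> U" "q \<in> U" "r \<in> U" "s \<in> U" using U by auto
  have xU: "\<not> E x p" "\<not> E x q" "\<not> E x r" "\<not> E x s" "\<not> E p x" "\<not> E q x" "\<not> E r x" "\<not> E s x"
    using inU U_x by blast+
  have z: "E z a" "E z b" "E z c" "E z d" "E a z" "E b z" "E c z" "E d z"
    "\<not> E z x" "\<not> E x z" if "z \<in> I" for z
    using that U_x sym unfolding I by blast+
  \<comment> \<open>Each of \<open>p\<close>, \<open>q\<close>, \<open>r\<close>, \<open>s\<close>
    sees a whole matching edge, which an adjacent \<open>z\<close> would share with it.\<close>
  have zU: "\<not> E z p" "\<not> E z q" "\<not> E z r" "\<not> E z s" "\<not> E p z" "\<not> E q z" "\<not> E r z" "\<not> E s z"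
    if "z \<in> I" for z
    using z[OF that] p q r s K4[of _ _ a b] K4[of _ _ c d] e sym by blast+
  have zz: "\<not> E z w" if "z \<in> I" "w \<in> I" for z w
    using z[OF that(1)] z[OF that(2)] K4[of z w a b] e by blast
  have ne: "p \<noteq> q" "p \<noteq> r" "p \<noteq> s" "q \<noteq> r" "q \<noteq> s" "r \<noteq> s" using p q r s by blast+
  have "card U = card {p, q, r, s} + card I"
    unfolding U using finU p q r s by (intro card_Un_disjoint) (auto simp: I)
  then have cardI: "card I = card V - 9" using ne card_V by simp
  moreover have "finite I" using finU unfolding I by simp
  ultimately obtain h where h: "bij_betw h {1..card V - 9} I"
    using ex_bij_betw_nat_finite_1 by metis
  define g where "g t = (case t of X \<Rightarrow> x
    | XI i \<Rightarrow> (if i = 1 then a else if i = 2 then b else if i = 3 then c else d)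
    | B i j k \<Rightarrow> (if k = 3 then p else if j = 2 then q else if i = 1 then r else s)
    | Z j \<Rightarrow> h j)" for t
  have hI: "h j \<in> I" if "j \<in> {1..card V - 9}" for j using h that by (auto simp: bij_betw_def)
  have g_simps: "g X = x" "g (XI 1) = a" "g (XI 2) = b" "g (XI 3) = c" "g (XI 4) = d"
    "g (B 1 2 3) = p" "g (B 1 2 4) = q" "g (B 1 3 4) = r" "g (B 2 3 4) = s" "g (Z j) = h j" for j
    by (simp_all add: g_def)
  have "g ` h4_verts (card V) = {x, a, b, c, d, p, q, r, s} \<union> h ` {1..card V - 9}"
    unfolding h4_verts_eq image_Un image_image g_simps image_insert image_empty ..
  also have "h ` {1..card V - 9} = I" using h by (simp add: bij_betw_def)
  also have "{x, a, b, c, d, p, q, r, s} \<union> I = insert x {a, b, c, d} \<union> ({p, q, r, s} \<union> I)" by auto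
  also have "\<dots> = V" by (rule V_eq[unfolded U, symmetric])
  finally have img: "g ` h4_verts (card V) = V" .
  moreover have "card (h4_verts (card V)) = card V" using card_verts_H4[of "card V"] V15 by (simp add: H4_def)
  moreover have "finite (h4_verts (card V))" by (simp add: h4_verts_eq)
  ultimately have "bij_betw g (h4_verts (card V)) V"
    unfolding bij_betw_def by (metis eq_card_imp_inj_on)
  moreover have "(u, v) \<in> parcs (H4 (card V)) \<longleftrightarrow> E (g u) (g v)"
    if uv: "u \<in> h4_verts (card V)" "v \<in> h4_verts (card V)" for u v
  proof -
    have c: "u = X \<or> u = XI 1 \<or> u = XI 2 \<or> u = XI 3 \<or> u = XI 4 \<or> u = B 1 2 3 \<or> u = B 1 2 4
      \<or> u = B 1 3 4 \<or> u = B 2 3 4 \<or> (\<exists>j\<in>{1..card V - 9}. u = Z j)"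
      if "u \<in> h4_verts (card V)" for u
      using that unfolding h4_verts_eq by auto
    note tab = e e' sy p q r s pqrs xU z zU zz x_nbrs irr
    show ?thesis
      using c[OF uv(1)] c[OF uv(2)]
      by (elim disjE bexE; hypsubst; unfold g_simps;
        simp add: H4_def h4_edges_def h4_triples_def tab hI)
  qed
  ultimately show ?thesis by blast
qed

lemma extremal_bound_2K2:
  assumes e: "E a b" "E c d" "\<not> E a c" "\<not> E a d" "\<not> E b c" "\<not> E b d"
  shows "extremal_bound V E"
  unfolding extremal_bound_def
proof
  show "2 * card V \<le> card triangles + 4"
    using excess_2K2(1)[OF e] triangles_ge by linarith
  show "card triangles + 4 = 2 * card V \<longrightarrow> (\<exists>g. bij_betw g (h4_verts (card V)) V \<and>
        (\<forall>s\<in>h4_verts (card V). \<forall>t\<in>h4_verts (card V). (s, t) \<in> parcs (H4 (card V)) \<longleftrightarrow> E (g s) (g t)))"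
  proof
    assume "card triangles + 4 = 2 * card V"
    then have "excess = 12" using excess_2K2(1)[OF e] triangles_ge by linarith
    from excess_2K2(2)[OF e this] show "\<exists>g. bij_betw g (h4_verts (card V)) V \<and>
        (\<forall>s\<in>h4_verts (card V). \<forall>t\<in>h4_verts (card V). (s, t) \<in> parcs (H4 (card V)) \<longleftrightarrow> E (g s) (g t))"
      by (elim exE conjE) (rule H4_map[OF e refl])
  qed
qed

text \<open>On four labelled vertices, excluding triangles and isolated vertices leaves only
  labelled copies of the four shapes, all excluded by the preceding lemmas.\<close>

lemma extremal_bound: "extremal_bound V E"
proof (rule ccontr)
  assume n: "\<not> extremal_bound V E"
  have perm: "K4_saturated_graph V E x a' b' c' d'"
    if "mset [a', b', c', d'] = mset [a, b, c, d]" for a' b' c' d'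
  proof (rule permute)
    show "distinct [a', b', c', d']" using dist that mset_eq_imp_distinct_iff by blast
    show "{a', b', c', d'} = {a, b, c, d}" using mset_eq_setD[OF that] by simp
  qed
  have s: "E b a = E a b" "E c a = E a c" "E d a = E a d" "E c b = E b c" "E d b = E b d" "E d c = E c d"
    using sym by blast+
  have star: "\<not> (E a' d' \<and> E b' d' \<and> E c' d' \<and> \<not> E a' b' \<and> \<not> E a' c' \<and> \<not> E b' c')"
    if "mset [a', b', c', d'] = mset [a, b, c, d]" for a' b' c' d'
    using K4_saturated_graph.extremal_bound_star[OF perm[OF that]] n by blast
  have P4: "\<not> (E a' b' \<and> E b' c' \<and> E c' d' \<and> \<not> E a' c' \<and> \<not> E a' d' \<and> \<not> E b' d')"
    if "mset [a', b', c', d'] = mset [a, b, c, d]" for a' b' c' d'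
    using K4_saturated_graph.extremal_bound_P4[OF perm[OF that]] n by blast
  have C4: "\<not> (E a' b' \<and> E b' c' \<and> E c' d' \<and> E a' d' \<and> \<not> E a' c' \<and> \<not> E b' d')"
    if "mset [a', b', c', d'] = mset [a, b, c, d]" for a' b' c' d'
    using K4_saturated_graph.extremal_bound_C4[OF perm[OF that]] n by blast
  have K2: "\<not> (E a' b' \<and> E c' d' \<and> \<not> E a' c' \<and> \<not> E a' d' \<and> \<not> E b' c' \<and> \<not> E b' d')"
    if "mset [a', b', c', d'] = mset [a, b, c, d]" for a' b' c' d'
    using K4_saturated_graph.extremal_bound_2K2[OF perm[OF that]] n by blast
  have iso: "E a' d' \<or> E b' d' \<or> E c' d'"
    if "mset [a', b', c', d'] = mset [a, b, c, d]" for a' b' c' d'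
    using K4_saturated_graph.not_isolated[OF perm[OF that]] .
  \<comment> \<open>Labellings up to symmetry: four stars (by centre, listed last), three matchings,
    three cycles and twelve paths.\<close>
  have m: "mset [b, c, d, a] = mset [a, b, c, d]" "mset [a, c, d, b] = mset [a, b, c, d]"
    "mset [a, b, d, c] = mset [a, b, c, d]" "mset [a, b, c, d] = mset [a, b, c, d]"
    "mset [a, c, b, d] = mset [a, b, c, d]" "mset [a, d, b, c] = mset [a, b, c, d]"
    "mset [a, c, d, b] = mset [a, b, c, d]" "mset [a, d, c, b] = mset [a, b, c, d]"
    "mset [b, a, c, d] = mset [a, b, c, d]" "mset [b, a, d, c] = mset [a, b, c, d]"
    "mset [b, c, a, d] = mset [a, b, c, d]" "mset [b, d, a, c] = mset [a, b, c, d]"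
    "mset [c, a, b, d] = mset [a, b, c, d]" "mset [c, b, a, d] = mset [a, b, c, d]"
    by (simp_all add: add_mset_commute)
  have tri: "\<not> (E a b \<and> E b c \<and> E a c)" "\<not> (E a b \<and> E b d \<and> E a d)"
    "\<not> (E a c \<and> E c d \<and> E a d)" "\<not> (E b c \<and> E c d \<and> E b d)"
    using no_triangle x_nbrs by blast+
  show False
    using star[OF m(1)] star[OF m(2)] star[OF m(3)] star[OF m(4)]
      iso[OF m(1)] iso[OF m(2)] iso[OF m(3)] iso[OF m(4)]
      K2[OF m(4)] K2[OF m(5)] K2[OF m(6)]
      C4[OF m(3)] C4[OF m(4)] C4[OF m(5)]
      P4[OF m(3)] P4[OF m(4)] P4[OF m(5)] P4[OF m(6)] P4[OF m(7)] P4[OF m(8)]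
      P4[OF m(9)] P4[OF m(10)] P4[OF m(11)] P4[OF m(12)] P4[OF m(13)] P4[OF m(14)]
      tri
    unfolding s by argo
qed

end

theorem theorem1:
  fixes G :: "'a pair_pre_digraph" and n :: nat
  assumes "n \<ge> 15"
    and "pair_graph G"
    and "card (pverts G) = n"
    and "complete_saturated 4 G"
    and "min_degree G = 4"
  shows "num_triangles G \<ge> 2 * n - 4 \<and>
    (num_triangles G = 2 * n - 4 \<longrightarrow> digraph_iso (with_proj G) (with_proj (H4 n)))"
proof -
  interpret pair_graph G by fact
  let ?V = "pverts G" and ?E = "\<lambda>u v. (u, v) \<in> parcs G"
  \<comment> \<open>Complete subgraphs are replaced by their vertex sets, both in G and in G with an
    added edge.\<close>
  define cliques :: "nat \<Rightarrow> 'a pair_pre_digraph \<Rightarrow> 'a set set" where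
    "cliques k H = {S. S \<subseteq> pverts H \<and> card S = k \<and> (\<forall>u\<in>S. \<forall>v\<in>S. u \<noteq> v \<longrightarrow> (u, v) \<in> parcs H)}"
    for k H
  have bij: "bij_betw pverts (complete_subgraphs k H) (cliques k H)" if "pair_graph H" for k H
    unfolding cliques_def using that by (rule bij_betw_complete_subgraphs)
  have sym: "(v, u) \<in> parcs G" if "(u, v) \<in> parcs G" for u v
    using that arcs_symmetric by blast
  have irr: "(u, u) \<notin> parcs G" for u using no_loops' by blast
  have EV: "u \<in> ?V" "v \<in> ?V" if "(u, v) \<in> parcs G" for u v
    using in_arcsD1 in_arcsD2 that by blast+
  have no4: "cliques 4 G = {}"
    using bij[OF assms(2), of 4] assms(4) by (simp add: complete_saturated_def bij_betw_def)
  have sat: "\<exists>p q. ?E p q \<and> ?E u p \<and> ?E u q \<and> ?E v p \<and> ?E v q"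
    if uv: "u \<in> ?V" "v \<in> ?V" "u \<noteq> v" "(u, v) \<notin> parcs G" for u v
  proof -
    let ?H = "add_edge G u v"
    have "pair_graph ?H"
    proof
      show "finite (pverts ?H)" "finite (parcs ?H)" by (simp_all add: add_edge_def)
      show "fst e \<in> pverts ?H" "snd e \<in> pverts ?H" "fst e \<noteq> snd e" if "e \<in> parcs ?H" for e
        using that uv EV irr by (cases e; auto simp: add_edge_def)+
      show "symmetric (with_proj ?H)"
        using sym by (auto simp: symmetric_def add_edge_def intro!: symI)
    qed
    moreover have "complete_subgraphs 4 ?H \<noteq> {}"
      using assms(4) uv by (simp add: complete_saturated_def)
    ultimately have "cliques 4 ?H \<noteq> {}" using bij[of ?H 4] by (auto simp: bij_betw_def)
    then obtain S where S: "S \<subseteq> ?V" "card S = 4"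
      and cl: "\<And>y z. y \<in> S \<Longrightarrow> z \<in> S \<Longrightarrow> y \<noteq> z \<Longrightarrow> (y, z) \<in> parcs G \<or> y = u \<and> z = v \<or> y = v \<and> z = u"
      unfolding cliques_def add_edge_def by auto
    \<comment> \<open>A clique missing \<open>u\<close> or \<open>v\<close> would not use the new
      edge and would already be a \<open>K4\<close> in G; its other two vertices are the required
      \<open>p\<close> and \<open>q\<close>.\<close>
    have uvS: "u \<in> S" "v \<in> S"
    proof -
      have "\<not> (\<forall>y\<in>S. \<forall>z\<in>S. y \<noteq> z \<longrightarrow> (y, z) \<in> parcs G)"
        using no4 S unfolding cliques_def by blast
      then show "u \<in> S" "v \<in> S" using cl by blast+
    qed
    have "card (S - {u, v}) = 2" using S uvS uv(3) by (simp add: card_Diff_subset)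
    then obtain p q where pq: "S - {u, v} = {p, q}" "p \<noteq> q" by (auto simp: card_2_iff)
    then have "p \<in> S" "q \<in> S" "p \<noteq> u" "p \<noteq> v" "q \<noteq> u" "q \<noteq> v" by blast+
    then show ?thesis using cl uvS pq(2) by metis
  qed
  have K4: False if "?E p q" "?E p r" "?E p s" "?E q r" "?E q s" "?E r s" for p q r s
  proof -
    have "{p, q, r, s} \<in> cliques 4 G"
      unfolding cliques_def using that irr EV sym by (auto simp: card_insert_if)
    then show False using no4 by blast
  qed
  have out: "out_degree (with_proj G) v = card {w. ?E v w}" for v
  proof -
    have "out_arcs (with_proj G) v = Pair v ` {w. ?E v w}"
      by (auto simp: out_arcs_def)
    then show ?thesis by (simp add: out_degree_def card_image inj_on_def)
  qed
  have fin: "finite (out_degree (with_proj G) ` ?V)" "out_degree (with_proj G) ` ?V \<noteq> {}"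
    using assms(1,3) by auto
  have deg: "4 \<le> card {w. ?E v w}" if "v \<in> ?V" for v
    using Min_le[OF fin(1)] that assms(5) out unfolding min_degree_def by fastforce
  obtain x where "x \<in> ?V" "card {w. ?E x w} = 4"
    using Min_in[OF fin] assms(5) out unfolding min_degree_def by auto
  moreover have "finite {w. ?E x w}" using EV by (auto intro: finite_subset[of _ ?V])
  ultimately obtain ws where ws: "set ws = {w. ?E x w}" "distinct ws" "length ws = 4"
    using finite_distinct_list distinct_card by metis
  then obtain a b c d where "ws = [a, b, c, d]"
    by (auto simp: numeral_eq_Suc length_Suc_conv)
  with ws have nx: "{w. ?E x w} = {a, b, c, d}" "distinct [a, b, c, d]" by auto
  interpret K: K4_saturated_graph ?V ?E x a b c d
  proof
    show "?E x w \<longleftrightarrow> w = a \<or> w = b \<or> w = c \<or> w = d" for w using nx(1) by blast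
    show "distinct [a, b, c, d]" by fact
    show "15 \<le> card ?V" using assms(1,3) by simp
    show "finite ?V" by simp
    show "4 \<le> card {w. ?E v w}" if "v \<in> ?V" for v using deg[OF that] .
    show "\<exists>p q. ?E p q \<and> ?E u p \<and> ?E u q \<and> ?E v p \<and> ?E v q"
      if "u \<in> ?V" "v \<in> ?V" "u \<noteq> v" "\<not> ?E u v" for u v using sat[OF that] .
    show False if "?E p q" "?E p r" "?E p s" "?E q r" "?E q s" "?E r s" for p q r s
      using K4[OF that] .
  qed (use sym irr EV in blast)+
  have "num_triangles G = card K.triangles"
    unfolding num_triangles_def K.triangles_def
    using bij_betw_same_card[OF bij[OF assms(2), of 3]] by (simp add: cliques_def)
  then have bound: "2 * n \<le> num_triangles G + 4"
    and ext: "num_triangles G + 4 = 2 * n \<Longrightarrow> \<exists>g. bij_betw g (h4_verts n) (pverts G) \<and>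
      (\<forall>s\<in>h4_verts n. \<forall>t\<in>h4_verts n. (s, t) \<in> parcs (H4 n) \<longleftrightarrow> (g s, g t) \<in> parcs G)"
    using K.extremal_bound unfolding extremal_bound_def assms(3) by simp_all
  have verts: "pverts (H4 n) = h4_verts n" by (simp add: H4_def)
  show ?thesis
  proof (intro conjI impI)
    show "2 * n - 4 \<le> num_triangles G" using bound by linarith
    assume "num_triangles G = 2 * n - 4"
    then have "num_triangles G + 4 = 2 * n" using assms(1) by linarith
    from ext[OF this] obtain g where g: "bij_betw g (pverts (H4 n)) (pverts G)"
      "\<forall>s\<in>pverts (H4 n). \<forall>t\<in>pverts (H4 n). (s, t) \<in> parcs (H4 n) \<longleftrightarrow> (g s, g t) \<in> parcs G"
      unfolding verts by blast
    show "digraph_iso (with_proj G) (with_proj (H4 n))"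
      by (rule digraph_isoI[OF assms(2) pair_graph_H4 g(1)]) (use g(2) in blast)
  qed
qed

end
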